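(* Let $1\le p<\infty$, let $X$ and $Y$ be Banach spaces and let $\Omega$ be a compact Hausdorff space. Suppose that $Y$ has the $p$-$(DPrcP)$. If $X$ has the $(DPP_p)$, then every dominated operator $T: C(\Omega,X)\to Y$ is $p$-convergent.
   Context: A sequence $(x_n)_n$ in a Banach space $X$ is weakly $p$-summable if $(x^*(x_n))_n\in\ell_p$ for every $x^*\in X^*$. A bounded set $K\subseteq X$ is a Dunford-Pettis set if every weakly null sequence $(x_n^* )_n$ in $X^*$ converges to $0$ uniformly on $K$. A Banach space $X$ has the $p$-Dunford-Pettis relatively compact property ($p$-$(DPrcP)$) if every weakly $p$-summable sequence in $X$ whose set of terms is a Dunford-Pettis set is norm null. A bounded linear operator $T:X\to Y$ is $p$-convergent if it takes weakly $p$-summable sequences in $X$ to norm null sequences in $Y$. A Banach space $X$ has the Dunford-Pettis property of order $p$, $(DPP_p)$, if for every Banach space $Z$ every weakly compact operator $X\to Z$ is $p$-convergent. $C(\Omega,X)$ is the Banach space of continuous functions $\Omega\to X$ with the supremum norm. A bounded linear operator $T:C(\Omega,X)\to Y$ is dominated if there is a positive linear functional $L$ on $C(\Omega)$ (i.e. a positive $L\in C(\Omega)^*$) such that $\|T(f)\|\le L(\|f\|)$ for all $f\in C(\Omega,X)$, where $\|f\|$ denotes the function $t\mapsto\|f(t)\|$. *)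

theory Defs
  imports "HOL-Analysis.Analysis"
begin

section \<open>Weak summability, Dunford--Pettis sets and \<open>p\<close>-convergent operators\<close>

definition weakly_null :: "(nat \<Rightarrow> 'a::real_normed_vector) \<Rightarrow> bool" where
  "weakly_null x \<longleftrightarrow> (\<forall>\<phi> :: 'a \<Rightarrow>\<^sub>L real. (\<lambda>n. blinfun_apply \<phi> (x n)) \<longlonglongrightarrow> 0)"

definition weakly_p_summable :: "real \<Rightarrow> (nat \<Rightarrow> 'a::real_normed_vector) \<Rightarrow> bool" where
  "weakly_p_summable p x \<longleftrightarrow>
     (\<forall>\<phi> :: 'a \<Rightarrow>\<^sub>L real. summable (\<lambda>n. \<bar>blinfun_apply \<phi> (x n)\<bar> powr p))"

text \<open>Here \<^const>\<open>weakly_null\<close> is used in the dual space, so it tests against the bidual.\<close>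

definition dunford_pettis_set :: "'a::real_normed_vector set \<Rightarrow> bool" where
  "dunford_pettis_set K \<longleftrightarrow> bounded K \<and>
     (\<forall>\<phi> :: nat \<Rightarrow> ('a \<Rightarrow>\<^sub>L real). weakly_null \<phi> \<longrightarrow>
        uniform_limit K (\<lambda>n x. blinfun_apply (\<phi> n) x) (\<lambda>_. 0) sequentially)"

definition has_DPrcP :: "real \<Rightarrow> 'a::real_normed_vector itself \<Rightarrow> bool" where
  "has_DPrcP p _ \<longleftrightarrow>
     (\<forall>x :: nat \<Rightarrow> 'a. weakly_p_summable p x \<longrightarrow> dunford_pettis_set (range x) \<longrightarrow> x \<longlonglongrightarrow> 0)"

definition p_convergent ::
    "real \<Rightarrow> ('a::real_normed_vector \<Rightarrow>\<^sub>L 'b::real_normed_vector) \<Rightarrow> bool" where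
  "p_convergent p T \<longleftrightarrow>
     (\<forall>x. weakly_p_summable p x \<longrightarrow> (\<lambda>n. blinfun_apply T (x n)) \<longlonglongrightarrow> 0)"

section \<open>Banach spaces as structures on a set\<close>

text \<open>
  The Dunford--Pettis property of order \<open>p\<close> quantifies over all Banach spaces \<open>Z\<close>. HOL cannot
  quantify over types inside a formula, so these spaces are represented by explicit structures on
  subsets of a fixed type.
\<close>

record 'z normed_str =
  car :: "'z set"
  vadd :: "'z \<Rightarrow> 'z \<Rightarrow> 'z"
  vzero :: "'z"
  vscale :: "real \<Rightarrow> 'z \<Rightarrow> 'z"
  vnorm :: "'z \<Rightarrow> real"

locale banach_str =
  fixes Z :: "'z normed_str"
  assumes zero_closed: "vzero Z \<in> car Z"
    and add_closed: "\<lbrakk>x \<in> car Z; y \<in> car Z\<rbrakk> \<Longrightarrow> vadd Z x y \<in> car Z"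
    and scale_closed: "x \<in> car Z \<Longrightarrow> vscale Z c x \<in> car Z"
    and add_assoc:
      "\<lbrakk>x \<in> car Z; y \<in> car Z; z \<in> car Z\<rbrakk> \<Longrightarrow> vadd Z (vadd Z x y) z = vadd Z x (vadd Z y z)"
    and add_commute: "\<lbrakk>x \<in> car Z; y \<in> car Z\<rbrakk> \<Longrightarrow> vadd Z x y = vadd Z y x"
    and add_zero: "x \<in> car Z \<Longrightarrow> vadd Z x (vzero Z) = x"
    and add_inverse: "x \<in> car Z \<Longrightarrow> vadd Z x (vscale Z (- 1) x) = vzero Z"
    and scale_add:
      "\<lbrakk>x \<in> car Z; y \<in> car Z\<rbrakk> \<Longrightarrow> vscale Z c (vadd Z x y) = vadd Z (vscale Z c x) (vscale Z c y)"
    and add_scale: "x \<in> car Z \<Longrightarrow> vscale Z (c + d) x = vadd Z (vscale Z c x) (vscale Z d x)"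
    and scale_scale: "x \<in> car Z \<Longrightarrow> vscale Z c (vscale Z d x) = vscale Z (c * d) x"
    and scale_one: "x \<in> car Z \<Longrightarrow> vscale Z 1 x = x"
    and norm_eq_zero: "x \<in> car Z \<Longrightarrow> vnorm Z x = 0 \<longleftrightarrow> x = vzero Z"
    and norm_triangle:
      "\<lbrakk>x \<in> car Z; y \<in> car Z\<rbrakk> \<Longrightarrow> vnorm Z (vadd Z x y) \<le> vnorm Z x + vnorm Z y"
    and norm_scale: "x \<in> car Z \<Longrightarrow> vnorm Z (vscale Z c x) = \<bar>c\<bar> * vnorm Z x"
    and complete:
      "\<lbrakk>\<And>n. s n \<in> car Z;
        \<forall>e>0. \<exists>N. \<forall>m\<ge>N. \<forall>n\<ge>N. vnorm Z (vadd Z (s m) (vscale Z (- 1) (s n))) < e\<rbrakk>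
       \<Longrightarrow> \<exists>l\<in>car Z. (\<lambda>n. vnorm Z (vadd Z (s n) (vscale Z (- 1) l))) \<longlonglongrightarrow> 0"

definition dual_str :: "'z normed_str \<Rightarrow> ('z \<Rightarrow> real) set" where
  "dual_str Z = {\<phi>.
     (\<forall>x\<in>car Z. \<forall>y\<in>car Z. \<phi> (vadd Z x y) = \<phi> x + \<phi> y) \<and>
     (\<forall>x\<in>car Z. \<forall>c. \<phi> (vscale Z c x) = c * \<phi> x) \<and>
     (\<exists>B. \<forall>x\<in>car Z. \<bar>\<phi> x\<bar> \<le> B * vnorm Z x)}"

definition weak_topology :: "'z normed_str \<Rightarrow> 'z topology" where
  "weak_topology Z =
     topology_generated_by {{z \<in> car Z. \<phi> z \<in> U} | \<phi> U. \<phi> \<in> dual_str Z \<and> open U}"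

definition bounded_operator_into ::
    "'z normed_str \<Rightarrow> ('x::real_normed_vector \<Rightarrow> 'z) \<Rightarrow> bool" where
  "bounded_operator_into Z T \<longleftrightarrow>
     range T \<subseteq> car Z \<and>
     (\<forall>x y. T (x + y) = vadd Z (T x) (T y)) \<and>
     (\<forall>c x. T (c *\<^sub>R x) = vscale Z c (T x)) \<and>
     (\<exists>B. \<forall>x. vnorm Z (T x) \<le> B * norm x)"

definition weakly_compact_into ::
    "'z normed_str \<Rightarrow> ('x::real_normed_vector \<Rightarrow> 'z) \<Rightarrow> bool" where
  "weakly_compact_into Z T \<longleftrightarrow> bounded_operator_into Z T \<and>
     compactin (weak_topology Z) (weak_topology Z closure_of (T ` cball 0 1))"

definition p_convergent_into ::
    "real \<Rightarrow> 'z normed_str \<Rightarrow> ('x::real_normed_vector \<Rightarrow> 'z) \<Rightarrow> bool" where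
  "p_convergent_into p Z T \<longleftrightarrow>
     (\<forall>x. weakly_p_summable p x \<longrightarrow> (\<lambda>n. vnorm Z (T (x n))) \<longlonglongrightarrow> 0)"

section \<open>The Dunford--Pettis property of order \<open>p\<close>\<close>

text \<open>
  \<open>Z\<close> ranges over all Banach spaces whose underlying set consists of functions \<open>'x \<Rightarrow> real\<close>.
  The bound on the size of \<open>Z\<close> is harmless: theorem \<open>has_DPP_imp_p_convergent\<close> below
  derives the property for weakly compact operators into an arbitrary Banach space type.
\<close>

definition has_DPP :: "real \<Rightarrow> 'x::real_normed_vector itself \<Rightarrow> bool" where
  "has_DPP p _ \<longleftrightarrow>
     (\<forall>(Z :: ('x \<Rightarrow> real) normed_str) (T :: 'x \<Rightarrow> ('x \<Rightarrow> real)).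
        banach_str Z \<longrightarrow> weakly_compact_into Z T \<longrightarrow> p_convergent_into p Z T)"

section \<open>Dominated operators\<close>

text \<open>
  For compact \<open>'w\<close> the type of bounded continuous functions on \<open>'w\<close> is \<open>C('w)\<close> with the
  supremum norm.
\<close>

definition pointwise_norm ::
    "('w::topological_space \<Rightarrow>\<^sub>C 'x::real_normed_vector) \<Rightarrow> ('w \<Rightarrow>\<^sub>C real)" where
  "pointwise_norm f = Bcontfun (\<lambda>t. norm (apply_bcontfun f t))"

lemma apply_pointwise_norm [simp]:
  "apply_bcontfun (pointwise_norm f) t = norm (apply_bcontfun f t)"
proof -
  have "(\<lambda>t. norm (apply_bcontfun f t)) \<in> bcontfun"
    unfolding bcontfun_def using bounded_apply_bcontfun[of f]
    by (auto intro!: continuous_on_norm simp: bounded_iff)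
  then show ?thesis by (simp add: pointwise_norm_def Bcontfun_inverse)
qed

definition dominated ::
    "(('w::topological_space \<Rightarrow>\<^sub>C 'x::real_normed_vector) \<Rightarrow>\<^sub>L 'y::real_normed_vector) \<Rightarrow> bool"
  where
  "dominated T \<longleftrightarrow>
     (\<exists>L :: ('w \<Rightarrow>\<^sub>C real) \<Rightarrow>\<^sub>L real.
        (\<forall>g. (\<forall>t. 0 \<le> apply_bcontfun g t) \<longrightarrow> 0 \<le> blinfun_apply L g) \<and>
        (\<forall>f. norm (blinfun_apply T f) \<le> blinfun_apply L (pointwise_norm f)))"

section \<open>Independence of the universe for \<open>Z\<close>\<close>

text \<open>Norming functionals, via minimal sublinear functionals.\<close>

definition sublinear :: "('a::real_vector \<Rightarrow> real) \<Rightarrow> bool" where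
  "sublinear q \<longleftrightarrow> (\<forall>x y. q (x + y) \<le> q x + q y) \<and> (\<forall>c x. 0 \<le> c \<longrightarrow> q (c *\<^sub>R x) = c * q x)"

lemma sublinear_zero: "sublinear q \<Longrightarrow> q 0 = 0"
  unfolding sublinear_def by (metis mult_zero_left order_refl scaleR_zero_left)

lemma sublinear_lower: "sublinear q \<Longrightarrow> - q (- x) \<le> q x"
proof -
  assume q: "sublinear q"
  then have "q (x + - x) \<le> q x + q (- x)" unfolding sublinear_def by blast
  then show ?thesis using sublinear_zero[OF q] by simp
qed

definition shave :: "('a::real_vector \<Rightarrow> real) \<Rightarrow> 'a \<Rightarrow> 'a \<Rightarrow> real" where
  "shave q y x = (INF t\<in>{0..}. q (x + t *\<^sub>R y) - t * q y)"

context
  fixes q :: "'a::real_vector \<Rightarrow> real" and y :: 'a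
  assumes q: "sublinear q"
begin

lemma shave_ge:
  assumes "0 \<le> t"
  shows "- q (- x) \<le> q (x + t *\<^sub>R y) - t * q y"
proof -
  have "q (t *\<^sub>R y) = q ((x + t *\<^sub>R y) + (- x))" by simp
  also have "\<dots> \<le> q (x + t *\<^sub>R y) + q (- x)"
    using q unfolding sublinear_def by blast
  finally show ?thesis using q assms unfolding sublinear_def by auto
qed

lemma shave_bdd: "bdd_below ((\<lambda>t. q (x + t *\<^sub>R y) - t * q y) ` {0..})"
  using shave_ge[of _ x] by (intro bdd_belowI[of _ "- q (- x)"]) auto

lemma shave_le: "0 \<le> t \<Longrightarrow> shave q y x \<le> q (x + t *\<^sub>R y) - t * q y"
  unfolding shave_def by (rule cINF_lower[OF shave_bdd]) auto

lemma shave_greatest: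
  "(\<And>t. 0 \<le> t \<Longrightarrow> b \<le> q (x + t *\<^sub>R y) - t * q y) \<Longrightarrow> b \<le> shave q y x"
  unfolding shave_def by (rule cINF_greatest) auto

lemma shave_le_self: "shave q y x \<le> q x"
  using shave_le[of 0 x] by simp

lemma shave_neg: "shave q y (- y) \<le> - q y"
  using shave_le[of 1 "- y"] sublinear_zero[OF q] by simp

lemma shave_scale_le:
  assumes "0 < c"
  shows "c * shave q y x \<le> shave q y (c *\<^sub>R x)"
proof (rule shave_greatest)
  fix t :: real assume t: "0 \<le> t"
  have "c * shave q y x \<le> c * (q (x + (t / c) *\<^sub>R y) - (t / c) * q y)"
    using shave_le[of "t / c" x] t assms by (intro mult_left_mono) auto
  also have "\<dots> = c * q (x + (t / c) *\<^sub>R y) - t * q y"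
    using assms by (simp add: right_diff_distrib)
  also have "c * q (x + (t / c) *\<^sub>R y) = q (c *\<^sub>R (x + (t / c) *\<^sub>R y))"
    using q assms unfolding sublinear_def by simp
  also have "c *\<^sub>R (x + (t / c) *\<^sub>R y) = c *\<^sub>R x + t *\<^sub>R y"
    using assms by (simp add: scaleR_right_distrib)
  finally show "c * shave q y x \<le> q (c *\<^sub>R x + t *\<^sub>R y) - t * q y" .
qed

lemma sublinear_shave: "sublinear (shave q y)"
  unfolding sublinear_def
proof (intro conjI allI impI)
  fix x z
  have key: "shave q y (x + z) - (q (z + t *\<^sub>R y) - t * q y) \<le> q (x + s *\<^sub>R y) - s * q y"
    if "0 \<le> s" "0 \<le> t" for s t
  proof -
    have "shave q y (x + z) \<le> q ((x + z) + (s + t) *\<^sub>R y) - (s + t) * q y"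
      using that by (intro shave_le) auto
    also have "(x + z) + (s + t) *\<^sub>R y = (x + s *\<^sub>R y) + (z + t *\<^sub>R y)"
      by (simp add: algebra_simps)
    also have "q \<dots> \<le> q (x + s *\<^sub>R y) + q (z + t *\<^sub>R y)"
      using q unfolding sublinear_def by blast
    finally show ?thesis by (simp add: algebra_simps)
  qed
  have "shave q y (x + z) - shave q y x \<le> q (z + t *\<^sub>R y) - t * q y" if "0 \<le> t" for t
  proof -
    have "shave q y (x + z) - (q (z + t *\<^sub>R y) - t * q y) \<le> shave q y x"
      using key that by (intro shave_greatest) auto
    then show ?thesis by linarith
  qed
  then have "shave q y (x + z) - shave q y x \<le> shave q y z"
    by (rule shave_greatest)
  then show "shave q y (x + z) \<le> shave q y x + shave q y z" by linarith
next
  fix c :: real and x assume c: "0 \<le> c"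
  show "shave q y (c *\<^sub>R x) = c * shave q y x"
  proof (cases "c = 0")
    case True
    have "shave q y 0 \<le> 0" using shave_le_self[of 0] sublinear_zero[OF q] by simp
    moreover have "0 \<le> shave q y 0"
      using q by (intro shave_greatest) (auto simp: sublinear_def)
    ultimately show ?thesis using True by simp
  next
    case False
    with c have "0 < c" by simp
    have "(1 / c) * shave q y (c *\<^sub>R x) \<le> shave q y ((1 / c) *\<^sub>R (c *\<^sub>R x))"
      using \<open>0 < c\<close> by (intro shave_scale_le) auto
    then have "shave q y (c *\<^sub>R x) \<le> c * shave q y x"
      using \<open>0 < c\<close> by (simp add: field_simps)
    with shave_scale_le[OF \<open>0 < c\<close>] show ?thesis by (simp add: antisym)
  qed
qed

end

lemma exists_linear_minorant:
  fixes r :: "'a::real_vector \<Rightarrow> real"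
  assumes r: "sublinear r"
  shows "\<exists>\<phi>. linear \<phi> \<and> (\<forall>x. \<phi> x \<le> r x)"
proof -
  define A where "A = {q :: 'a \<Rightarrow> real. sublinear q \<and> q \<le> r}"
  define P where "P = (\<lambda>q q' :: 'a \<Rightarrow> real. q' \<le> q)"
  have po: "partial_order_on A (relation_of P A)"
    unfolding P_def by (rule partial_order_on_relation_ofI) auto
  have "\<exists>m\<in>A. \<forall>a\<in>A. P m a \<longrightarrow> a = m"
  proof (rule predicate_Zorn[OF po])
    fix C assume C: "C \<in> Chains (relation_of P A)"
    have CA: "C \<subseteq> A" using C unfolding Chains_def relation_of_def by auto
    have tot: "a \<le> b \<or> b \<le> a" if "a \<in> C" "b \<in> C" for a b
      using C that unfolding Chains_def relation_of_def P_def by auto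
    show "\<exists>u\<in>A. \<forall>a\<in>C. P a u"
    proof (cases "C = {}")
      case True then show ?thesis using r unfolding A_def by auto
    next
      case False
      define u where "u x = (INF q\<in>C. q x)" for x
      have low: "- r (- x) \<le> q x" if "q \<in> C" for q x
      proof -
        have "sublinear q" "q (- x) \<le> r (- x)"
          using that CA unfolding A_def by (auto simp: le_fun_def)
        then show ?thesis using sublinear_lower[of q x] by linarith
      qed
      have bdd: "bdd_below ((\<lambda>q. q x) ` C)" for x
        using low by (intro bdd_belowI[of _ "- r (- x)"]) auto
      have u_le: "u x \<le> q x" if "q \<in> C" for q x
        unfolding u_def using that by (intro cINF_lower bdd)
      have u_ge: "b \<le> u x" if "\<And>q. q \<in> C \<Longrightarrow> b \<le> q x" for b x
        unfolding u_def using that False by (intro cINF_greatest) auto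
      have subC: "q (x + y) \<le> q x + q y" "0 \<le> c \<Longrightarrow> q (c *\<^sub>R x) = c * q x"
        if "q \<in> C" for q x y c
        using that CA unfolding A_def sublinear_def by auto
      have uscale: "c * u x \<le> u (c *\<^sub>R x)" if "0 \<le> c" for c x
      proof (rule u_ge)
        fix q assume "q \<in> C"
        then show "c * u x \<le> q (c *\<^sub>R x)"
          using subC(2)[of q c x] that mult_left_mono[OF u_le[of q x] that] by simp
      qed
      have "sublinear u" unfolding sublinear_def
      proof (intro conjI allI impI)
        fix x y
        have k: "u (x + y) \<le> q x + q' y" if "q \<in> C" "q' \<in> C" for q q'
        proof (cases "q \<le> q'")
          case True
          have "u (x + y) \<le> q x + q y"
            using u_le[OF that(1)] subC(1)[OF that(1)] order_trans by blast
          then show ?thesis using True le_funD[of q q' y] by linarith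
        next
          case False
          then have *: "q' \<le> q" using tot that by blast
          have "u (x + y) \<le> q' x + q' y"
            using u_le[OF that(2)] subC(1)[OF that(2)] order_trans by blast
          then show ?thesis using le_funD[OF *, of x] by linarith
        qed
        have "u (x + y) - u x \<le> q' y" if "q' \<in> C" for q'
        proof -
          have "u (x + y) - q' y \<le> u x" using k that by (intro u_ge) (simp add: algebra_simps)
          then show ?thesis by linarith
        qed
        then have "u (x + y) - u x \<le> u y" by (rule u_ge)
        then show "u (x + y) \<le> u x + u y" by linarith
      next
        fix c :: real and x assume c: "0 \<le> c"
        show "u (c *\<^sub>R x) = c * u x"
        proof (cases "c = 0")
          case True
          have "q 0 = 0" if "q \<in> C" for q
            using that CA unfolding A_def by (auto intro: sublinear_zero)
          then have "(\<lambda>q. q 0) ` C = {0}" using False by (auto simp: image_iff)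
          then have "u 0 = 0" unfolding u_def by simp
          then show ?thesis using True by simp
        next
          case c0: False
          have "(1 / c) * u (c *\<^sub>R x) \<le> u ((1 / c) *\<^sub>R (c *\<^sub>R x))"
            using c by (intro uscale) auto
          then have "u (c *\<^sub>R x) \<le> c * u x" using c c0 by (simp add: field_simps)
          with uscale[OF c] show ?thesis by (simp add: antisym)
        qed
      qed
      moreover have "u \<le> r"
      proof -
        obtain q where "q \<in> C" using False by auto
        moreover from this have "q \<le> r" using CA unfolding A_def by auto
        ultimately show ?thesis using u_le by (meson le_funI order_trans le_funD)
      qed
      ultimately show ?thesis using u_le unfolding A_def P_def by (auto simp: le_fun_def)
    qed
  qed
  then obtain m where m: "m \<in> A" and min: "\<And>a. a \<in> A \<Longrightarrow> a \<le> m \<Longrightarrow> a = m"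
    unfolding P_def by blast
  have sm: "sublinear m" and mr: "m \<le> r" using m unfolding A_def by auto
  have neg: "m (- y) = - m y" for y
  proof -
    have "shave m y \<le> m" using shave_le_self[OF sm] by (simp add: le_fun_def)
    moreover from this have "shave m y \<in> A"
      using sublinear_shave[OF sm] mr unfolding A_def by auto
    ultimately have "shave m y = m" using min by blast
    then have "m (- y) \<le> - m y" using shave_neg[OF sm, of y] by simp
    with sublinear_lower[OF sm, of y] show ?thesis by linarith
  qed
  have "linear m"
  proof (rule linearI)
    fix x y
    have "m (x + y) \<le> m x + m y" using sm unfolding sublinear_def by blast
    moreover have "m (- x + - y) \<le> m (- x) + m (- y)" using sm unfolding sublinear_def by blast
    ultimately show "m (x + y) = m x + m y" using neg[of "x + y"] neg[of x] neg[of y] by simp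
  next
    fix c :: real and x
    show "m (c *\<^sub>R x) = c *\<^sub>R m x"
    proof (cases "0 \<le> c")
      case True then show ?thesis using sm unfolding sublinear_def by simp
    next
      case False
      then have "m ((- c) *\<^sub>R x) = - c * m x"
        using sm[unfolded sublinear_def, THEN conjunct2, rule_format, of "- c" x] by simp
      then show ?thesis using neg[of "c *\<^sub>R x"] by simp
    qed
  qed
  then show ?thesis using mr by (auto simp: le_fun_def)
qed

lemma exists_norming_functional:
  fixes z :: "'z::real_normed_vector"
  shows "\<exists>\<phi> :: 'z \<Rightarrow>\<^sub>L real. (\<forall>w. \<bar>blinfun_apply \<phi> w\<bar> \<le> norm w) \<and> \<bar>blinfun_apply \<phi> z\<bar> = norm z"
proof -
  have n: "sublinear (norm :: 'z \<Rightarrow> real)"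
    unfolding sublinear_def by (auto intro: norm_triangle_ineq)
  obtain \<phi> where l: "linear \<phi>" and le: "\<And>x. \<phi> x \<le> shave norm z x"
    using exists_linear_minorant[OF sublinear_shave[OF n]] by blast
  have neg: "\<phi> (- x) = - \<phi> x" for x using l by (simp add: linear_neg)
  have up: "\<phi> x \<le> norm x" for x using le[of x] shave_le_self[OF n, of z x] by linarith
  have b: "\<bar>\<phi> x\<bar> \<le> norm x" for x using up[of x] up[of "- x"] neg[of x] by simp
  have "bounded_linear \<phi>"
    by (rule linear_conv_bounded_linear[THEN iffD1] bounded_linear_intro[where K = 1])+
       (use l b in \<open>auto simp: linear_add linear_scale\<close>)
  moreover have zz: "norm z \<le> \<phi> z"
    using le[of "- z"] shave_neg[OF n, of z] neg[of z] by linarith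
  moreover have nn: "0 \<le> \<phi> z" using zz norm_ge_zero[of z] by linarith
  ultimately show ?thesis
    using b up[of z]
    by (intro exI[of _ "Blinfun \<phi>"])
       (auto simp: bounded_linear_Blinfun_apply abs_of_nonneg[OF nn])
qed

definition type_str :: "'z::real_normed_vector normed_str" where
  "type_str = \<lparr>car = UNIV, vadd = (+), vzero = 0, vscale = scaleR, vnorm = norm\<rparr>"

lemma banach_str_type_str: "banach_str (type_str :: 'z::banach normed_str)"
proof
  fix s :: "nat \<Rightarrow> 'z"
  assume "\<forall>e>0. \<exists>N. \<forall>m\<ge>N. \<forall>n\<ge>N.
    vnorm type_str (vadd type_str (s m) (vscale type_str (- 1) (s n))) < e"
  then have "Cauchy s" by (simp add: type_str_def Cauchy_def dist_norm)
  then obtain l where "s \<longlonglongrightarrow> l" by (auto simp: Cauchy_convergent_iff convergent_def)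
  then show "\<exists>l\<in>car type_str.
      (\<lambda>n. vnorm type_str (vadd type_str (s n) (vscale type_str (- 1) l))) \<longlonglongrightarrow> 0"
    by (auto simp: type_str_def tendsto_norm_zero_iff LIM_zero_iff intro!: exI[of _ l])
qed (auto simp: type_str_def algebra_simps norm_triangle_ineq)

definition linf_str :: "('i \<Rightarrow> real) normed_str" where
  "linf_str = \<lparr>car = {g. bounded (range g)}, vadd = (\<lambda>g h i. g i + h i), vzero = (\<lambda>_. 0),
     vscale = (\<lambda>c g i. c * g i), vnorm = (\<lambda>g. SUP i. \<bar>g i\<bar>)\<rparr>"

lemma linf_bdd: "g \<in> car linf_str \<Longrightarrow> bdd_above (range (\<lambda>i. \<bar>g i\<bar>))"
  unfolding linf_str_def bounded_iff bdd_above_def by auto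

lemma linf_upper: "g \<in> car linf_str \<Longrightarrow> \<bar>g i\<bar> \<le> vnorm linf_str g"
  using linf_bdd[of g] unfolding linf_str_def by (auto intro: cSUP_upper)

lemma linf_least: "(\<And>i. \<bar>g i\<bar> \<le> B) \<Longrightarrow> vnorm linf_str g \<le> B"
  unfolding linf_str_def by (auto intro: cSUP_least)

lemma linf_memI: "(\<And>i. \<bar>g i\<bar> \<le> B) \<Longrightarrow> g \<in> car linf_str"
  unfolding linf_str_def bounded_iff by auto

lemma linf_nonneg: "g \<in> car linf_str \<Longrightarrow> 0 \<le> vnorm linf_str g"
  using linf_upper[of g undefined] by linarith

lemma linf_simps:
  "vadd linf_str g h = (\<lambda>i. g i + h i)" "vzero linf_str = (\<lambda>_. 0)"
  "vscale linf_str c g = (\<lambda>i. c * g i)"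
  unfolding linf_str_def by simp_all

lemma linf_add: "g \<in> car linf_str \<Longrightarrow> h \<in> car linf_str \<Longrightarrow> (\<lambda>i. g i + h i) \<in> car linf_str"
  by (rule linf_memI[of _ "vnorm linf_str g + vnorm linf_str h"])
     (rule order_trans[OF abs_triangle_ineq add_mono[OF linf_upper linf_upper]])

lemma linf_scale: "g \<in> car linf_str \<Longrightarrow> (\<lambda>i. c * g i) \<in> car linf_str"
  by (rule linf_memI[of _ "\<bar>c\<bar> * vnorm linf_str g"])
     (simp add: abs_mult linf_upper mult_left_mono)

lemma banach_str_linf_str: "banach_str (linf_str :: ('i \<Rightarrow> real) normed_str)"
proof
  fix g :: "'i \<Rightarrow> real" and c :: real assume g: "g \<in> car linf_str"
  have "g = (\<lambda>_. 0)" if "vnorm linf_str g = 0"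
    using linf_upper[OF g] that by fastforce
  moreover have "vnorm linf_str (\<lambda>_::'i. 0 :: real) = 0" by (simp add: linf_str_def)
  ultimately show "(vnorm linf_str g = 0) = (g = vzero linf_str)"
    by (auto simp: linf_simps)
  have a: "vnorm linf_str (\<lambda>i. d * h i) \<le> \<bar>d\<bar> * vnorm linf_str h"
    if "h \<in> car linf_str" for d and h :: "'i \<Rightarrow> real"
    using that by (intro linf_least) (simp add: abs_mult linf_upper mult_left_mono)
  show "vnorm linf_str (vscale linf_str c g) = \<bar>c\<bar> * vnorm linf_str g"
  proof (cases "c = 0")
    case True
    then show ?thesis by (simp add: linf_simps) (simp add: linf_str_def)
  next
    case False
    have "vnorm linf_str (\<lambda>i. inverse c * (c * g i)) \<le> \<bar>inverse c\<bar> * vnorm linf_str (\<lambda>i. c * g i)"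
      using a linf_scale[OF g] by blast
    moreover have "(\<lambda>i. inverse c * (c * g i)) = g" using False by auto
    ultimately have "\<bar>c\<bar> * vnorm linf_str g \<le> vnorm linf_str (\<lambda>i. c * g i)"
      using False by (simp add: field_simps)
    with a[OF g, of c] show ?thesis by (simp add: linf_simps)
  qed
next
  fix g h :: "'i \<Rightarrow> real" assume g: "g \<in> car linf_str" and h: "h \<in> car linf_str"
  show "vnorm linf_str (vadd linf_str g h) \<le> vnorm linf_str g + vnorm linf_str h"
    unfolding linf_simps
    by (rule linf_least) (rule order_trans[OF abs_triangle_ineq add_mono[OF linf_upper[OF g] linf_upper[OF h]]])
next
  fix s :: "nat \<Rightarrow> 'i \<Rightarrow> real"
  assume s: "\<And>n. s n \<in> car linf_str"
    and C: "\<forall>e>0. \<exists>N. \<forall>m\<ge>N. \<forall>n\<ge>N.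
      vnorm linf_str (vadd linf_str (s m) (vscale linf_str (- 1) (s n))) < e"
  have mem: "(\<lambda>i. s m i + - 1 * s n i) \<in> car linf_str" for m n
    using linf_add[OF s linf_scale[OF s]] by blast
  have C': "\<exists>N. \<forall>m\<ge>N. \<forall>n\<ge>N. \<forall>i. \<bar>s m i - s n i\<bar> < e" if "e > 0" for e
  proof -
    obtain N where N: "\<And>m n. m \<ge> N \<Longrightarrow> n \<ge> N \<Longrightarrow> vnorm linf_str (\<lambda>i. s m i + - 1 * s n i) < e"
      using C \<open>e > 0\<close> unfolding linf_simps by blast
    have "\<bar>s m i - s n i\<bar> < e" if "m \<ge> N" "n \<ge> N" for m n and i :: 'i
      using N[OF that] linf_upper[OF mem[of m n], of i] by simp
    then show ?thesis by blast
  qed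
  have "Cauchy (\<lambda>n. s n i)" for i :: 'i
    unfolding Cauchy_def dist_real_def using C' by meson
  moreover define l where "l i = lim (\<lambda>n. s n i)" for i
  ultimately have l: "(\<lambda>n. s n i) \<longlonglongrightarrow> l i" for i
    by (simp add: Cauchy_convergent_iff convergent_LIMSEQ_iff)
  have U: "\<exists>N. \<forall>n\<ge>N. \<forall>i. \<bar>s n i - l i\<bar> \<le> e" if e: "e > 0" for e
  proof -
    obtain N where N: "\<And>m n i. m \<ge> N \<Longrightarrow> n \<ge> N \<Longrightarrow> \<bar>s m i - s n i\<bar> < e" using C'[OF e] by blast
    have "\<bar>s n i - l i\<bar> \<le> e" if "n \<ge> N" for n and i :: 'i
    proof (rule LIMSEQ_le_const2)
      show "(\<lambda>m. \<bar>s n i - s m i\<bar>) \<longlonglongrightarrow> \<bar>s n i - l i\<bar>" by (intro tendsto_intros l)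
      show "\<exists>M. \<forall>m\<ge>M. \<bar>s n i - s m i\<bar> \<le> e" using N that by (meson less_imp_le)
    qed
    then show ?thesis by blast
  qed
  obtain N where N: "\<And>i. \<bar>s N i - l i\<bar> \<le> 1" using U[of 1] by force
  have lm: "l \<in> car linf_str"
  proof (rule linf_memI)
    fix i show "\<bar>l i\<bar> \<le> vnorm linf_str (s N) + 1"
      using N[of i] linf_upper[OF s[of N], of i] by linarith
  qed
  have mem': "(\<lambda>i. s n i + - 1 * l i) \<in> car linf_str" for n
    using linf_add[OF s linf_scale[OF lm]] by blast
  have "(\<lambda>n. vnorm linf_str (\<lambda>i. s n i + - 1 * l i)) \<longlonglongrightarrow> 0"
  proof (rule LIMSEQ_I)
    fix e :: real assume "0 < e"
    then obtain M where M: "\<And>n i. n \<ge> M \<Longrightarrow> \<bar>s n i - l i\<bar> \<le> e / 2" using U[of "e / 2"] by auto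
    have "norm (vnorm linf_str (\<lambda>i. s n i + - 1 * l i) - 0) < e" if "n \<ge> M" for n
    proof -
      have "vnorm linf_str (\<lambda>i. s n i + - 1 * l i) \<le> e / 2"
        using M[OF that] by (intro linf_least) simp
      then show ?thesis using linf_nonneg[OF mem', of n] \<open>0 < e\<close> by simp
    qed
    then show "\<exists>M. \<forall>n\<ge>M. norm (vnorm linf_str (\<lambda>i. s n i + - 1 * l i) - 0) < e" by blast
  qed
  then show "\<exists>l\<in>car linf_str.
      (\<lambda>n. vnorm linf_str (vadd linf_str (s n) (vscale linf_str (- 1) l))) \<longlonglongrightarrow> 0"
    using lm unfolding linf_simps by blast
next
  show "vzero linf_str \<in> car (linf_str :: ('i \<Rightarrow> real) normed_str)"
    unfolding linf_simps by (rule linf_memI[of _ 0]) simp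
qed (simp_all only: linf_simps linf_add linf_scale, simp_all add: algebra_simps)

lemma topspace_weak_topology: "topspace (weak_topology Z) = car Z"
proof -
  have "(\<lambda>_. 0) \<in> dual_str Z" unfolding dual_str_def by (auto intro: exI[of _ 0])
  then have "car Z \<in> {{z \<in> car Z. \<phi> z \<in> U} |\<phi> U. \<phi> \<in> dual_str Z \<and> open U}"
    by (intro CollectI exI[of _ "\<lambda>_. 0"] exI[of _ UNIV]) auto
  then show ?thesis unfolding weak_topology_def topology_generated_by_topspace by auto
qed

lemma openin_weak_topology:
  "\<phi> \<in> dual_str Z \<Longrightarrow> open U \<Longrightarrow> openin (weak_topology Z) {z \<in> car Z. \<phi> z \<in> U}"
  unfolding weak_topology_def by (rule topology_generated_by_Basis) blast

lemma continuous_map_weak_topology: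
  assumes J: "\<And>z. z \<in> car Z \<Longrightarrow> J z \<in> car W"
    and dual: "\<And>\<phi>. \<phi> \<in> dual_str W \<Longrightarrow> \<phi> \<circ> J \<in> dual_str Z"
  shows "continuous_map (weak_topology Z) (weak_topology W) J"
  unfolding weak_topology_def[of W] continuous_on_generated_topo_iff
proof (intro conjI allI impI)
  fix V assume "V \<in> {{z \<in> car W. \<phi> z \<in> U} |\<phi> U. \<phi> \<in> dual_str W \<and> open U}"
  then obtain \<phi> U where V: "V = {z \<in> car W. \<phi> z \<in> U}" "\<phi> \<in> dual_str W" "open U" by blast
  have "J -` V \<inter> topspace (weak_topology Z) = {z \<in> car Z. (\<phi> \<circ> J) z \<in> U}"
    using J unfolding topspace_weak_topology V(1) by auto
  then show "openin (weak_topology Z) (J -` V \<inter> topspace (weak_topology Z))"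
    using openin_weak_topology[OF dual[OF V(2)] V(3)] by simp
next
  have "\<Union> {{z \<in> car W. \<phi> z \<in> U} |\<phi> U. \<phi> \<in> dual_str W \<and> open U} = car W"
    using topspace_weak_topology[of W]
    unfolding weak_topology_def topology_generated_by_topspace .
  then show "J ` topspace (weak_topology Z)
      \<subseteq> \<Union> {{z \<in> car W. \<phi> z \<in> U} |\<phi> U. \<phi> \<in> dual_str W \<and> open U}"
    using J topspace_weak_topology[of Z] by auto
qed

lemma Hausdorff_weak_linf: "Hausdorff_space (weak_topology (linf_str :: ('i \<Rightarrow> real) normed_str))"
  unfolding Hausdorff_space_def topspace_weak_topology
proof (intro allI impI)
  fix g h :: "'i \<Rightarrow> real"
  assume gh: "g \<in> car linf_str \<and> h \<in> car linf_str \<and> g \<noteq> h"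
  then obtain i where i: "g i \<noteq> h i" by blast
  then obtain U V where UV: "open U" "open V" "g i \<in> U" "h i \<in> V" "U \<inter> V = {}"
    using hausdorff[OF i] by blast
  have bd: "\<forall>f\<in>car linf_str. \<bar>f i\<bar> \<le> 1 * vnorm linf_str f"
    by (simp add: linf_upper)
  have ev: "(\<lambda>f. f i) \<in> dual_str linf_str"
    unfolding dual_str_def linf_simps using bd by blast
  let ?A = "\<lambda>W. {f \<in> car linf_str. f i \<in> W}"
  have "openin (weak_topology linf_str) (?A U)" "openin (weak_topology linf_str) (?A V)"
    using openin_weak_topology[OF ev UV(1)] openin_weak_topology[OF ev UV(2)] .
  moreover have "g \<in> ?A U" "h \<in> ?A V" using gh UV(3,4) by simp_all
  moreover have "disjnt (?A U) (?A V)" unfolding disjnt_def using UV(5) by blast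
  ultimately show "\<exists>U V. openin (weak_topology linf_str) U \<and> openin (weak_topology linf_str) V \<and>
      g \<in> U \<and> h \<in> V \<and> disjnt U V"
    by (intro exI[of _ "?A U"] exI[of _ "?A V"] conjI)
qed

theorem has_DPP_imp_p_convergent:
  fixes T :: "'x::real_normed_vector \<Rightarrow>\<^sub>L 'z::banach"
  assumes dpp: "has_DPP p TYPE('x)"
    and wc: "weakly_compact_into type_str (blinfun_apply T)"
  shows "p_convergent p T"
proof -
  obtain \<phi> :: "'x \<Rightarrow> 'z \<Rightarrow>\<^sub>L real" where
    b: "\<And>x w. \<bar>blinfun_apply (\<phi> x) w\<bar> \<le> norm w" and
    nm: "\<And>x. \<bar>blinfun_apply (\<phi> x) (T x)\<bar> = norm (T x)"
    using that choice[of "\<lambda>x \<phi>. (\<forall>w. \<bar>blinfun_apply \<phi> w\<bar> \<le> norm w) \<and>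
      \<bar>blinfun_apply \<phi> (blinfun_apply T x)\<bar> = norm (blinfun_apply T x)"]
      exists_norming_functional by blast
  define J where "J = (\<lambda>w x. blinfun_apply (\<phi> x) w)"
  have Jm: "J w \<in> car linf_str" for w
    unfolding J_def using b by (rule linf_memI)
  have Jn: "vnorm linf_str (J w) \<le> norm w" for w
    unfolding J_def using b by (rule linf_least)
  have JT: "norm (T x) \<le> vnorm linf_str (J (T x))" for x
    using linf_upper[OF Jm[of "blinfun_apply T x"], of x] nm[of x] unfolding J_def by simp
  have Jadd: "J (v + w) = vadd linf_str (J v) (J w)" for v w
    unfolding J_def linf_simps by (simp add: blinfun.add_right)
  have Jsc: "J (c *\<^sub>R w) = vscale linf_str c (J w)" for c w
    unfolding J_def linf_simps by (simp add: blinfun.scaleR_right)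
  have cont: "continuous_map (weak_topology type_str) (weak_topology linf_str) J"
  proof (rule continuous_map_weak_topology)
    fix \<psi> :: "('x \<Rightarrow> real) \<Rightarrow> real" assume psi: "\<psi> \<in> dual_str linf_str"
    then obtain B where B: "\<And>g. g \<in> car linf_str \<Longrightarrow> \<bar>\<psi> g\<bar> \<le> B * vnorm linf_str g"
      unfolding dual_str_def by blast
    have "\<bar>\<psi> (J w)\<bar> \<le> \<bar>B\<bar> * norm w" for w
    proof -
      have "B * vnorm linf_str (J w) \<le> \<bar>B\<bar> * vnorm linf_str (J w)"
        using linf_nonneg[OF Jm] by (intro mult_right_mono) auto
      also have "\<dots> \<le> \<bar>B\<bar> * norm w" using Jn by (intro mult_left_mono) auto
      finally show ?thesis using B[OF Jm, of w] by linarith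
    qed
    moreover have "\<psi> (J (v + w)) = \<psi> (J v) + \<psi> (J w)" "\<psi> (J (c *\<^sub>R w)) = c * \<psi> (J w)" for v w c
      using psi Jm unfolding dual_str_def Jadd Jsc by auto
    ultimately show "\<psi> \<circ> J \<in> dual_str type_str"
      unfolding dual_str_def type_str_def by auto
  qed (rule Jm)
  define K where "K = weak_topology type_str closure_of (blinfun_apply T ` cball 0 1)"
  have "compactin (weak_topology linf_str) (J ` K)"
    using wc image_compactin[OF _ cont] unfolding weakly_compact_into_def K_def by blast
  moreover from this have "closedin (weak_topology linf_str) (J ` K)"
    using compactin_imp_closedin[OF Hausdorff_weak_linf] by blast
  moreover have "(J \<circ> T) ` cball 0 1 \<subseteq> J ` K"
  proof -
    have "blinfun_apply T ` cball 0 1 \<subseteq> K"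
      unfolding K_def by (rule closure_of_subset) (simp add: topspace_weak_topology type_str_def)
    then show ?thesis by auto
  qed
  ultimately have "compactin (weak_topology linf_str)
      (weak_topology linf_str closure_of ((J \<circ> T) ` cball 0 1))"
    by (meson closed_compactin closedin_closure_of closure_of_minimal)
  moreover have "bounded_operator_into linf_str (J \<circ> T)"
  proof -
    have "vnorm linf_str (J (T x)) \<le> norm T * norm x" for x
      using Jn[of "T x"] norm_blinfun[of T x] by linarith
    then show ?thesis
      unfolding bounded_operator_into_def using Jm
      by (auto simp: blinfun.add_right blinfun.scaleR_right Jadd Jsc)
  qed
  ultimately have "weakly_compact_into linf_str (J \<circ> T)"
    unfolding weakly_compact_into_def by blast
  then have pc: "p_convergent_into p linf_str (J \<circ> T)"
    using dpp banach_str_linf_str unfolding has_DPP_def by blast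
  show ?thesis
    unfolding p_convergent_def
  proof (intro allI impI)
    fix x :: "nat \<Rightarrow> 'x" assume "weakly_p_summable p x"
    then have "(\<lambda>n. vnorm linf_str (J (T (x n)))) \<longlonglongrightarrow> 0"
      using pc unfolding p_convergent_into_def by simp
    then show "(\<lambda>n. T (x n)) \<longlonglongrightarrow> 0"
      by (rule Lim_null_comparison[rotated]) (simp add: JT)
  qed
qed

end

theory Submission
  imports Defs
begin

text \<open>
  A dominated operator \<open>T\<close> carries a weakly \<open>p\<close>-summable sequence \<open>f\<close> to a weakly \<open>p\<close>-summable
  sequence, so by the property of \<open>Y\<close> it suffices that the vectors \<open>T (f m)\<close> form a Dunford--Pettis
  set: for every weakly null sequence \<open>\<phi>\<close> in the dual of \<open>Y\<close>, \<open>\<phi> n (T (f m))\<close> tends to zero as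
  \<open>m\<close> grows, uniformly in \<open>n\<close>.

  Heuristically \<open>\<phi> (T f) = \<integral> G\<^sub>t (\<phi>, f t) dL(t)\<close> for a density \<open>t \<mapsto> G\<^sub>t\<close> whose values
  are bilinear forms of norm at most one on the product of the dual of \<open>Y\<close> with \<open>X\<close>. For fixed \<open>t\<close>
  the form \<open>G\<^sub>t\<close> maps the dual of \<open>Y\<close> linearly to the dual of \<open>X\<close>, so \<open>\<phi>\<close> becomes weakly null there,
  while \<open>f m t\<close> is weakly \<open>p\<close>-summable in \<open>X\<close>. The Dunford--Pettis property of \<open>X\<close>, applied to the
  operator \<open>x \<mapsto> (\<psi> n x)\<^sub>n\<close> that a weakly null sequence \<open>\<psi>\<close> defines
  (\<open>has_DPP_weakly_null_uniform\<close>), makes the integrands tend to zero pointwise, and dominated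
  convergence would finish the proof.

  The density and the integral are replaced by finite averages. The pairs \<open>(t, G)\<close> of a point
  and a form of norm at most one make up a compact space, on which
  \<open>(t, G) \<mapsto> G (\<phi> n, f m t)\<close> is continuous. A partition of unity \<open>e\<close> replaces the density by finitely many averages \<open>\<phi> (T (e x)) / L e\<close>
  (\<open>dominated_average_form\<close>), hence \<open>\<phi> (T f)\<close> by a finite average over that compact space. In
  place of dominated convergence stands Simons' theorem that a bounded sequence of continuous
  functions tending to zero pointwise on a compact space has finite convex combinations that are
  small everywhere (\<open>pointwise_null_imp_small_convex_combination\<close>); a finite convex combination
  involves finitely many functions, so one partition of unity serves them all.
\<close>

section \<open>Convex combinations of pointwise null sequences\<close>

text \<open>
  The finite convex combinations of \<open>z k, z (k + 1), \<dots>\<close>, generated from two-term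
  combinations so that bounds, continuity and averages pass to them by rule induction.
\<close>

inductive_set convex_tail :: "(nat \<Rightarrow> 'k \<Rightarrow> real) \<Rightarrow> nat \<Rightarrow> ('k \<Rightarrow> real) set"
  for z :: "nat \<Rightarrow> 'k \<Rightarrow> real" and k :: nat where
  member: "k \<le> n \<Longrightarrow> z n \<in> convex_tail z k"
| combine: "f \<in> convex_tail z k \<Longrightarrow> g \<in> convex_tail z k \<Longrightarrow> 0 \<le> a \<Longrightarrow> a \<le> 1 \<Longrightarrow>
    (\<lambda>x. a * f x + (1 - a) * g x) \<in> convex_tail z k"

lemma convex_tail_antimono: "g \<in> convex_tail z l \<Longrightarrow> k \<le> l \<Longrightarrow> g \<in> convex_tail z k"
  by (induction rule: convex_tail.induct) (auto intro: convex_tail.intros)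

lemma convex_tail_upper:
  assumes "g \<in> convex_tail z k" "\<And>n. k \<le> n \<Longrightarrow> z n x \<le> b"
  shows "g x \<le> b"
  using assms(1)
proof induction
  case (combine f g a)
  then show ?case using convex_bound_le[of "f x" b "g x" a "1 - a"] by simp
qed (use assms(2) in auto)

lemma convex_tail_abs_bound:
  assumes "g \<in> convex_tail z k" "\<And>n. \<bar>z n x\<bar> \<le> M"
  shows "\<bar>g x\<bar> \<le> M"
  using assms(1)
proof induction
  case (combine f g a)
  have "\<bar>a * f x + (1 - a) * g x\<bar> \<le> a * \<bar>f x\<bar> + (1 - a) * \<bar>g x\<bar>"
    using combine(3,4) by (intro order_trans[OF abs_triangle_ineq]) (simp add: abs_mult)
  also have "\<dots> \<le> M"
    using combine convex_bound_le[of "\<bar>f x\<bar>" M "\<bar>g x\<bar>" a "1 - a"] by simp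
  finally show ?case .
qed (use assms(2) in auto)

lemma continuous_on_convex_tail:
  assumes "g \<in> convex_tail z k" "\<And>n. continuous_on K (z n)"
  shows "continuous_on K g"
  using assms(1)
proof induction
  case (combine f g a)
  then show ?case by (intro continuous_intros)
qed (use assms(2) in auto)

text \<open>
  The argument is Simons'. Suppose that every convex combination \<open>g\<close> reaches the value \<open>c\<close> on
  \<open>K\<close>. Build \<open>h\<^sub>\<infinity> = \<Sum>\<^sub>k g\<^sub>k / 2\<^sup>k\<^sup>+\<^sup>1\<close>, an infinite convex combination, where
  \<open>g\<^sub>k\<close> is taken from the \<open>k\<close>-th tail so that it nearly minimises
  \<open>sup (h\<^sub>k + g / 2\<^sup>k)\<close>, with \<open>h\<^sub>k\<close> the partial sum. Since the
  remainder \<open>h\<^sub>\<infinity> - h\<^sub>k\<close> is itself \<open>2\<^sup>-\<^sup>k\<close> times a uniform limit of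
  convex combinations of the \<open>k\<close>-th tail, near-minimality gives
  \<open>h\<^sub>k + g\<^sub>k / 2\<^sup>k \<le> sup h\<^sub>\<infinity> + d / 4\<^sup>k\<close>. At a point \<open>\<kappa>\<close> where the
  continuous function \<open>h\<^sub>\<infinity>\<close> attains its maximum, this says that the
  remainder \<open>r\<^sub>k = h\<^sub>\<infinity> \<kappa> - h\<^sub>k \<kappa>\<close> shrinks at most by half in one step, up to a small
  error: \<open>r\<^sub>k \<le> 2 r\<^sub>k\<^sub>+\<^sub>1 + d / 4\<^sup>k\<close>. Hence
  \<open>h\<^sub>\<infinity> \<kappa> = r\<^sub>0 \<le> 2\<^sup>k r\<^sub>k + 2 d\<close>, and \<open>2\<^sup>k r\<^sub>k\<close> is at most the supremum of
  \<open>z n \<kappa>\<close> over \<open>n \<ge> k\<close>, which is small because \<open>z n \<kappa> \<longlonglongrightarrow> 0\<close>. So \<open>c \<le> 3 d\<close>, which is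
  false for \<open>d = c / 4\<close>.
\<close>

theorem pointwise_null_imp_small_convex_combination:
  fixes z :: "nat \<Rightarrow> 'k::topological_space \<Rightarrow> real"
  assumes K: "compact K" and cont: "\<And>n. continuous_on K (z n)"
    and bound: "\<And>n x. x \<in> K \<Longrightarrow> \<bar>z n x\<bar> \<le> M"
    and null: "\<And>x. x \<in> K \<Longrightarrow> (\<lambda>n. z n x) \<longlonglongrightarrow> 0"
    and c: "0 < c"
  shows "\<exists>g\<in>convex_tail z 0. \<forall>x\<in>K. g x < c"
proof (rule ccontr)
  assume "\<not> ?thesis"
  then have big: "\<exists>x\<in>K. c \<le> g x" if "g \<in> convex_tail z 0" for g
    using that by force
  obtain x0 where x0: "x0 \<in> K" using big[OF member[of 0 0]] by auto
  have M0: "0 \<le> M" using bound[OF x0, of 0] by linarith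
  define d where "d = c / 4"
  have d: "0 < d" using c by (simp add: d_def)
  define P where "P h = (SUP x\<in>K. h x)" for h :: "'k \<Rightarrow> real"
  have P_upper: "h x \<le> P h" if "x \<in> K" "\<And>y. y \<in> K \<Longrightarrow> h y \<le> B" for h x B
    unfolding P_def using that by (intro cSUP_upper bdd_aboveI[of _ B]) auto
  have P_least: "P h \<le> B" if "\<And>y. y \<in> K \<Longrightarrow> h y \<le> B" for h B
    unfolding P_def using that x0 by (intro cSUP_least) auto
  have conv_bound: "\<bar>g x\<bar> \<le> M" if "g \<in> convex_tail z k" "x \<in> K" for g k x
    using convex_tail_abs_bound[OF that(1)] bound[OF that(2)] by blast
  have near_min: "\<exists>g\<in>convex_tail z k. \<forall>g'\<in>convex_tail z k.
      P (\<lambda>x. h x + g x / 2^k) \<le> P (\<lambda>x. h x + g' x / 2^k) + d / 4^k"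
    if h: "\<And>x. x \<in> K \<Longrightarrow> h x \<le> B" for h k B
  proof -
    let ?Q = "\<lambda>g. P (\<lambda>x. h x + g x / 2^k)"
    have lower: "h x0 - M / 2^k \<le> ?Q g" if g: "g \<in> convex_tail z k" for g
    proof -
      have "h y + g y / 2^k \<le> B + M / 2^k" if "y \<in> K" for y
        using h[OF that] conv_bound[OF g that] by (intro add_mono divide_right_mono) auto
      then have "h x0 + g x0 / 2^k \<le> ?Q g" by (rule P_upper[OF x0])
      moreover have "- M / 2^k \<le> g x0 / 2^k"
        using conv_bound[OF g x0] by (intro divide_right_mono) auto
      ultimately show ?thesis by simp
    qed
    have bdd: "bdd_below (?Q ` convex_tail z k)"
      using lower by (intro bdd_belowI) auto
    have ne: "convex_tail z k \<noteq> {}" using member[of k k z] by auto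
    have "(INF g\<in>convex_tail z k. ?Q g) < (INF g\<in>convex_tail z k. ?Q g) + d / 4^k"
      using d by simp
    then obtain g where g: "g \<in> convex_tail z k"
      "?Q g < (INF g\<in>convex_tail z k. ?Q g) + d / 4^k"
      unfolding cINF_less_iff[OF ne bdd] by blast
    have "?Q g \<le> ?Q g' + d / 4^k" if "g' \<in> convex_tail z k" for g'
      using g(2) cINF_lower[OF bdd that] by linarith
    then show ?thesis using g(1) by blast
  qed
  define pick where "pick k h = (SOME g. g \<in> convex_tail z k \<and> (\<forall>g'\<in>convex_tail z k.
      P (\<lambda>x. h x + g x / 2^k) \<le> P (\<lambda>x. h x + g' x / 2^k) + d / 4^k))" for k h
  have pick: "pick k h \<in> convex_tail z k"
    "\<And>g'. g' \<in> convex_tail z k \<Longrightarrow>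
      P (\<lambda>x. h x + pick k h x / 2^k) \<le> P (\<lambda>x. h x + g' x / 2^k) + d / 4^k"
    if "\<And>x. x \<in> K \<Longrightarrow> h x \<le> B" for h k B
    using someI_ex[OF near_min[where h = h and k = k, OF that, unfolded Bex_def]]
    unfolding pick_def by blast+
  define h where "h = rec_nat (\<lambda>_. 0) (\<lambda>k u x. u x + pick k u x / 2^(Suc k))"
  have h0: "h 0 x = 0" and hSuc: "h (Suc k) x = h k x + pick k (h k) x / 2^(Suc k)" for k x
    by (simp_all add: h_def)
  define g where "g k = pick k (h k)" for k
  have h_bdd: "\<exists>B. \<forall>x\<in>K. h k x \<le> B" for k
  proof (induction k)
    case 0 show ?case by (auto simp: h0)
  next
    case (Suc k)
    then obtain B where B: "\<And>x. x \<in> K \<Longrightarrow> h k x \<le> B" by auto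
    then have mem: "pick k (h k) \<in> convex_tail z k" by (rule pick(1))
    have "h (Suc k) x \<le> B + M / 2^(Suc k)" if "x \<in> K" for x
      unfolding hSuc using B[OF that] conv_bound[OF mem that]
      by (intro add_mono divide_right_mono) auto
    then show ?case by blast
  qed
  have g: "g k \<in> convex_tail z k" for k
    using h_bdd[of k] pick(1)[of "h k"] unfolding g_def by blast
  have g_min: "P (\<lambda>x. h k x + g k x / 2^k) \<le> P (\<lambda>x. h k x + g' x / 2^k) + d / 4^k"
    if "g' \<in> convex_tail z k" for k g'
    using h_bdd[of k] pick(2)[of "h k", OF _ that] unfolding g_def by blast
  have hS: "h (Suc k) x = h k x + g k x / 2^(Suc k)" for k x
    unfolding g_def by (rule hSuc)
  have h_sum: "h k x = (\<Sum>j<k. g j x / 2^(Suc j))" for k x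
    by (induction k) (simp_all add: h0 hS)
  have gM: "\<bar>g k x\<bar> \<le> M" if "x \<in> K" for k x using conv_bound[OF g that] .
  define hinf where "hinf x = (\<Sum>j. g j x / 2^(Suc j))" for x
  have unif: "uniform_limit K h hinf sequentially"
    unfolding h_sum[abs_def] hinf_def[abs_def]
  proof (rule Weierstrass_m_test)
    show "norm (g n x / 2^(Suc n)) \<le> M / 2^(Suc n)" if "x \<in> K" for n x
      using gM[OF that, of n] by (simp add: divide_right_mono)
    show "summable (\<lambda>n. M / 2^(Suc n))"
      using summable_mult[OF summable_geometric[of "1/2::real"], of "M / 2"]
      by (simp add: power_divide)
  qed
  have h_cont: "continuous_on K (h k)" for k
    unfolding h_sum[abs_def]
    by (intro continuous_intros continuous_on_convex_tail[OF g cont]) auto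
  have hinf_cont: "continuous_on K hinf"
    by (rule uniform_limit_theorem[OF _ unif]) (auto simp: h_cont)
  have h_lim: "(\<lambda>k. h k x) \<longlonglongrightarrow> hinf x" if "x \<in> K" for x
    using tendsto_uniform_limitI[OF unif that] .
  have h_incr: "h (k + J) x - h k x \<le> b * (1 / 2^k - 1 / 2^(k + J))"
    if "\<And>j. k \<le> j \<Longrightarrow> g j x \<le> b" for k J x b
  proof (induction J)
    case (Suc J)
    have "g (k + J) x / 2^(Suc (k + J)) \<le> b / 2^(Suc (k + J))"
      using that[of "k + J"] by (intro divide_right_mono) auto
    moreover have "b * (1 / 2^k - 1 / 2^(k + Suc J)) =
        b * (1 / 2^k - 1 / 2^(k + J)) + b / 2^(Suc (k + J))"
      by (simp add: field_simps)
    ultimately show ?case using Suc hS[of "k + J" x] by simp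
  qed simp
  have rest_upper: "hinf x - h k x \<le> b / 2^k"
    if x: "x \<in> K" and b: "0 \<le> b" "\<And>j. k \<le> j \<Longrightarrow> g j x \<le> b" for k x b
  proof (rule LIMSEQ_le_const2)
    show "(\<lambda>J. h (k + J) x - h k x) \<longlonglongrightarrow> hinf x - h k x"
      using LIMSEQ_ignore_initial_segment[OF h_lim[OF x], of k]
      by (intro tendsto_intros) (simp add: add.commute)
    show "\<exists>N. \<forall>J\<ge>N. h (k + J) x - h k x \<le> b / 2^k"
    proof (intro exI allI impI)
      fix J
      have "b * (1 / 2^k - 1 / 2^(k + J)) \<le> b * (1 / 2^k)"
        using b(1) by (intro mult_left_mono) auto
      then show "h (k + J) x - h k x \<le> b / 2^k" using h_incr[OF b(2)] order_trans by fastforce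
    qed
  qed
  have rest_lower: "- M / 2^k \<le> hinf x - h k x" if x: "x \<in> K" for k x
  proof (rule LIMSEQ_le_const)
    show "(\<lambda>J. h (k + J) x - h k x) \<longlonglongrightarrow> hinf x - h k x"
      using LIMSEQ_ignore_initial_segment[OF h_lim[OF x], of k]
      by (intro tendsto_intros) (simp add: add.commute)
    have "- M * (1 / 2^k - 1 / 2^(k + J)) \<le> h (k + J) x - h k x" for J
    proof (induction J)
      case (Suc J)
      have "- M / 2^(Suc (k + J)) \<le> g (k + J) x / 2^(Suc (k + J))"
        using gM[OF x, of "k + J"] by (intro divide_right_mono) auto
      moreover have "- M * (1 / 2^k - 1 / 2^(k + Suc J)) =
          - M * (1 / 2^k - 1 / 2^(k + J)) + - M / 2^(Suc (k + J))"
        by (simp add: field_simps)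
      ultimately show ?case using Suc hS[of "k + J" x] by simp
    qed simp
    moreover have "- M / 2^k \<le> - M * (1 / 2^k - 1 / 2^(k + J))" for J
      using M0 by (simp add: field_simps)
    ultimately show "\<exists>N. \<forall>J\<ge>N. - M / 2^k \<le> h (k + J) x - h k x"
      using order_trans by blast
  qed
  \<comment> \<open>Rescaled, the increment from \<open>h k\<close> to \<open>h (k + J)\<close> is a convex combination of the \<open>k\<close>-th tail only
    after the missing weight \<open>1 / 2^J\<close> is given to one more member, \<open>g (k + J)\<close>.\<close>
  have tail: "(\<lambda>x. 2^k * (h (k + J) x - h k x) + g (k + J) x / 2^J) \<in> convex_tail z k" for k J
  proof (induction J arbitrary: k)
    case 0 show ?case using g[of k] by simp
  next
    case (Suc J)
    let ?c = "\<lambda>x. 2^(Suc k) * (h (Suc k + J) x - h (Suc k) x) + g (Suc k + J) x / 2^J"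
    have "(\<lambda>x. 1/2 * g k x + (1 - 1/2) * ?c x) \<in> convex_tail z k"
      by (intro combine g convex_tail_antimono[OF Suc]) auto
    also have "(\<lambda>x. 1/2 * g k x + (1 - 1/2) * ?c x) =
        (\<lambda>x. 2^k * (h (k + Suc J) x - h k x) + g (k + Suc J) x / 2^(Suc J))"
      by (rule ext) (simp add: hS[of k] field_simps)
    finally show ?case .
  qed
  have near_hinf: "h k x + g k x / 2^k \<le> hinf x + 2 * (M / 2^k)" if "x \<in> K" for k x
  proof -
    have "g k x / 2^k \<le> M / 2^k" using gM[OF that, of k] by (intro divide_right_mono) auto
    then show ?thesis using rest_lower[OF that, of k] by simp
  qed
  obtain \<kappa> where \<kappa>: "\<kappa> \<in> K" and max: "\<And>x. x \<in> K \<Longrightarrow> hinf x \<le> hinf \<kappa>"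
    using continuous_attains_sup[OF K _ hinf_cont] x0 by blast
  have small: "(\<lambda>J. 2 * (M / 2^(k + J))) \<longlonglongrightarrow> 0" for k
  proof -
    have "(\<lambda>J. (2 * M / 2^k) * (1/2)^J) \<longlonglongrightarrow> (2 * M / 2^k) * 0"
      by (intro tendsto_intros LIMSEQ_power_zero) simp
    then show ?thesis by (simp add: power_add power_divide field_simps)
  qed
  \<comment> \<open>The competitor for \<open>g k\<close> is the rescaled increment up to \<open>h (k + J)\<close>; then \<open>J\<close> tends to infinity.\<close>
  have step: "h k \<kappa> + g k \<kappa> / 2^k \<le> hinf \<kappa> + d / 4^k" for k
  proof -
    have "h k \<kappa> + g k \<kappa> / 2^k \<le> hinf \<kappa> + 2 * (M / 2^(k + J)) + d / 4^k" for J
    proof -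
      have "h k \<kappa> + g k \<kappa> / 2^k \<le> P (\<lambda>x. h k x + g k x / 2^k)"
      proof (rule P_upper[OF \<kappa>])
        show "h k y + g k y / 2^k \<le> hinf \<kappa> + 2 * (M / 2^k)" if "y \<in> K" for y
          using near_hinf[OF that, of k] max[OF that] by linarith
      qed
      also have "\<dots> \<le> P (\<lambda>x. h k x + (2^k * (h (k + J) x - h k x) + g (k + J) x / 2^J) / 2^k)
          + d / 4^k"
        by (rule g_min[OF tail])
      also have "(\<lambda>x. h k x + (2^k * (h (k + J) x - h k x) + g (k + J) x / 2^J) / 2^k) =
          (\<lambda>x. h (k + J) x + g (k + J) x / 2^(k + J))"
        by (rule ext) (simp add: field_simps power_add)
      also have "P \<dots> \<le> hinf \<kappa> + 2 * (M / 2^(k + J))"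
        using near_hinf max by (intro P_least) (meson add_right_mono order_trans)
      finally show ?thesis by simp
    qed
    then have "\<exists>N. \<forall>J\<ge>N. h k \<kappa> + g k \<kappa> / 2^k \<le> hinf \<kappa> + 2 * (M / 2^(k + J)) + d / 4^k"
      by blast
    moreover have "(\<lambda>J. hinf \<kappa> + 2 * (M / 2^(k + J)) + d / 4^k) \<longlonglongrightarrow> hinf \<kappa> + 0 + d / 4^k"
      by (intro tendsto_intros small)
    ultimately show ?thesis using LIMSEQ_le_const by fastforce
  qed
  have doubling: "hinf \<kappa> \<le> 2^k * (hinf \<kappa> - h k \<kappa>) + 2 * d * (1 - 1 / 2^k)" for k
  proof (induction k)
    case (Suc k)
    have four: "(4::real)^k = 2^k * 2^k" by (simp flip: power_mult_distrib)
    have "hinf \<kappa> - h k \<kappa> \<le> 2 * (hinf \<kappa> - h (Suc k) \<kappa>) + d / 4^k"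
      using step[of k] by (simp add: hS field_simps)
    then have "2^k * (hinf \<kappa> - h k \<kappa>) \<le> 2^k * (2 * (hinf \<kappa> - h (Suc k) \<kappa>) + d / 4^k)"
      by (intro mult_left_mono) auto
    also have "\<dots> = 2^(Suc k) * (hinf \<kappa> - h (Suc k) \<kappa>) + d / 2^k"
      by (simp add: four field_simps)
    finally have "2^k * (hinf \<kappa> - h k \<kappa>) \<le> 2^(Suc k) * (hinf \<kappa> - h (Suc k) \<kappa>) + d / 2^k" .
    moreover have "2 * d * (1 - 1 / 2^(Suc k)) = 2 * d * (1 - 1 / 2^k) + d / 2^k"
      by (simp add: field_simps)
    ultimately show ?case using Suc by linarith
  qed (simp add: h0)
  have "c \<le> hinf \<kappa>"
  proof -
    have "c \<le> hinf \<kappa> + 2 * (M / 2^(0 + J))" for J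
      using big[OF tail[of 0 J]] near_hinf[of _ J] max by (fastforce simp: h0)
    moreover have "(\<lambda>J. hinf \<kappa> + 2 * (M / 2^(0 + J))) \<longlonglongrightarrow> hinf \<kappa> + 0"
      by (intro tendsto_intros small)
    ultimately show ?thesis using LIMSEQ_le_const by fastforce
  qed
  moreover have "hinf \<kappa> \<le> 3 * d"
  proof -
    obtain k where k: "\<And>n. k \<le> n \<Longrightarrow> z n \<kappa> \<le> d"
      using LIMSEQ_D[OF null[OF \<kappa>] d] by fastforce
    have "g j \<kappa> \<le> d" if "k \<le> j" for j
      using convex_tail_upper[OF g[of j]] k that by force
    then have "hinf \<kappa> - h k \<kappa> \<le> d / 2^k" using d by (intro rest_upper[OF \<kappa>]) auto
    then have "2^k * (hinf \<kappa> - h k \<kappa>) \<le> d" by (simp add: field_simps)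
    moreover have "2 * d * (1 - 1 / 2^k) \<le> 2 * d" using d by (simp add: field_simps)
    ultimately show ?thesis using doubling[of k] by linarith
  qed
  ultimately show False using c by (simp add: d_def)
qed

text \<open>
  A lower bound for the averages of the first \<open>N\<close> functions carries over to every convex
  combination of them. The number \<open>N\<close> depends on the combination alone, which allows the average
  to be chosen afterwards.
\<close>

lemma convex_tail_average:
  fixes z :: "nat \<Rightarrow> 'k \<Rightarrow> real"
  assumes "g \<in> convex_tail z k"
  shows "\<exists>N. \<forall>(I :: 'i set) w \<kappa>. (\<forall>n<N. c \<le> (\<Sum>i\<in>I. w i * z n (\<kappa> i))) \<longrightarrow>
    c \<le> (\<Sum>i\<in>I. w i * g (\<kappa> i))"
  using assms
proof induction
  case (member n)
  show ?case by (intro exI[of _ "Suc n"]) simp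
next
  case (combine f g a)
  then obtain N1 N2 where
    N1: "\<And>(I :: 'i set) w \<kappa>. (\<forall>n<N1. c \<le> (\<Sum>i\<in>I. w i * z n (\<kappa> i))) \<Longrightarrow>
      c \<le> (\<Sum>i\<in>I. w i * f (\<kappa> i))" and
    N2: "\<And>(I :: 'i set) w \<kappa>. (\<forall>n<N2. c \<le> (\<Sum>i\<in>I. w i * z n (\<kappa> i))) \<Longrightarrow>
      c \<le> (\<Sum>i\<in>I. w i * g (\<kappa> i))"
    by blast
  show ?case
  proof (intro exI[of _ "max N1 N2"] allI impI)
    fix I :: "'i set" and w \<kappa>
    assume "\<forall>n<max N1 N2. c \<le> (\<Sum>i\<in>I. w i * z n (\<kappa> i))"
    then have "c \<le> (\<Sum>i\<in>I. w i * f (\<kappa> i))" "c \<le> (\<Sum>i\<in>I. w i * g (\<kappa> i))"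
      by (auto intro!: N1 N2)
    then have "a * c + (1 - a) * c \<le>
        a * (\<Sum>i\<in>I. w i * f (\<kappa> i)) + (1 - a) * (\<Sum>i\<in>I. w i * g (\<kappa> i))"
      using combine.hyps by (intro add_mono mult_left_mono) auto
    also have "\<dots> = (\<Sum>i\<in>I. w i * (a * f (\<kappa> i) + (1 - a) * g (\<kappa> i)))"
      unfolding sum_distrib_left sum.distrib[symmetric] by (simp add: algebra_simps)
    finally show "c \<le> (\<Sum>i\<in>I. w i * (a * f (\<kappa> i) + (1 - a) * g (\<kappa> i)))"
      by (simp add: algebra_simps)
  qed
qed

section \<open>Uniform boundedness and weakly summable sequences\<close>

text \<open>
  One of the closed sets on which all members of \<open>F\<close> are bounded by \<open>k\<close> contains a ball, by the
  Baire category theorem; boundedness on a ball is boundedness in norm.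
\<close>

theorem banach_steinhaus:
  fixes F :: "('a::banach \<Rightarrow>\<^sub>L 'b::real_normed_vector) set"
  assumes pw: "\<And>x. bounded ((\<lambda>f. blinfun_apply f x) ` F)"
  shows "bounded F"
proof -
  define A where "A k = {x. \<forall>f\<in>F. norm (blinfun_apply f x) \<le> real k}" for k
  have closed: "closed (A k)" for k
  proof -
    have "A k = (\<Inter>f\<in>F. {x. norm (blinfun_apply f x) \<le> real k})" unfolding A_def by blast
    then show ?thesis by (auto intro!: closed_Collect_le continuous_intros)
  qed
  have "x \<in> (\<Union>k. A k)" for x
  proof -
    obtain B where "\<And>f. f \<in> F \<Longrightarrow> norm (blinfun_apply f x) \<le> B"
      using pw[of x] unfolding bounded_iff by blast
    moreover obtain k :: nat where "B \<le> real k" using real_arch_simple by blast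
    ultimately have "\<forall>f\<in>F. norm (blinfun_apply f x) \<le> real k" using order_trans by blast
    then show ?thesis unfolding A_def by blast
  qed
  then have cover: "(\<Union>k. A k) = UNIV" by blast
  have "\<exists>k. interior (A k) \<noteq> {}"
  proof (rule ccontr)
    assume "\<nexists>k. interior (A k) \<noteq> {}"
    then have "Met_TC.mtopology interior_of \<Union>(range A) = ({} :: 'a set)"
      by (intro Met_TC.metric_Baire_category_alt)
        (auto simp: Met_TC.mcomplete_def Cauchy_convergent_iff convergent_def closed)
    then show False using cover by simp
  qed
  then obtain k x e where e: "0 < e" "ball x e \<subseteq> A k"
    unfolding interior_def open_contains_ball by blast
  have "norm f \<le> 4 * real k / e" if f: "f \<in> F" for f
  proof (rule norm_blinfun_bound)
    fix y
    have xk: "norm (blinfun_apply f x) \<le> real k" using e f unfolding A_def by force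
    show "norm (blinfun_apply f y) \<le> 4 * real k / e * norm y"
    proof (cases "y = 0")
      case False
      define u where "u = (e / (2 * norm y)) *\<^sub>R y"
      have "norm u = e / 2" using False e by (simp add: u_def)
      then have "x + u \<in> A k" using e by (intro subsetD[OF e(2)]) (simp add: dist_norm)
      then have "norm (blinfun_apply f (x + u)) \<le> real k" using f unfolding A_def by blast
      moreover have "blinfun_apply f u = blinfun_apply f (x + u) - blinfun_apply f x"
        by (simp add: blinfun.add_right)
      ultimately have "norm (blinfun_apply f u) \<le> 2 * real k"
        using xk norm_triangle_ineq4[of "blinfun_apply f (x + u)" "blinfun_apply f x"] by simp
      then show ?thesis using False e by (simp add: u_def blinfun.scaleR_right field_simps)
    qed simp
  qed (use e in auto)
  then show ?thesis unfolding bounded_iff by blast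
qed

definition bidual_eval :: "'a::real_normed_vector \<Rightarrow> ('a \<Rightarrow>\<^sub>L real) \<Rightarrow>\<^sub>L real" where
  "bidual_eval x = Blinfun (\<lambda>\<phi>. blinfun_apply \<phi> x)"

lemma bidual_eval_apply [simp]: "blinfun_apply (bidual_eval x) \<phi> = blinfun_apply \<phi> x"
  unfolding bidual_eval_def
  by (simp add: bounded_linear_Blinfun_apply blinfun.bounded_linear_left)

lemma weakly_null_pointwise:
  fixes \<phi> :: "nat \<Rightarrow> 'a::real_normed_vector \<Rightarrow>\<^sub>L real"
  assumes "weakly_null \<phi>"
  shows "(\<lambda>n. blinfun_apply (\<phi> n) x) \<longlonglongrightarrow> 0"
  using assms[unfolded weakly_null_def, rule_format, of "bidual_eval x"] by simp

lemma weakly_null_dual_bounded: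
  fixes \<phi> :: "nat \<Rightarrow> 'a::banach \<Rightarrow>\<^sub>L real"
  assumes "weakly_null \<phi>"
  shows "bounded (range \<phi>)"
proof (rule banach_steinhaus)
  show "bounded ((\<lambda>f. blinfun_apply f x) ` range \<phi>)" for x
    using convergent_imp_bounded[OF weakly_null_pointwise[OF assms]] by (simp add: image_image)
qed

text \<open>
  The set acts on the dual, which is a Banach space whatever the space itself is, and norming
  functionals recover the norm of a vector from that action.
\<close>

lemma weakly_bounded_imp_bounded:
  fixes S :: "'a::real_normed_vector set"
  assumes "\<And>\<phi> :: 'a \<Rightarrow>\<^sub>L real. bounded (blinfun_apply \<phi> ` S)"
  shows "bounded S"
proof -
  have "bounded (bidual_eval ` S)"
    by (rule banach_steinhaus) (simp add: image_image assms)
  then obtain B where B: "\<And>x. x \<in> S \<Longrightarrow> norm (bidual_eval x) \<le> B"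
    unfolding bounded_iff by blast
  have "norm x \<le> B" if "x \<in> S" for x
  proof -
    obtain \<phi> :: "'a \<Rightarrow>\<^sub>L real"
      where \<phi>: "\<And>w. \<bar>blinfun_apply \<phi> w\<bar> \<le> norm w" "\<bar>blinfun_apply \<phi> x\<bar> = norm x"
      using exists_norming_functional by blast
    have "norm \<phi> \<le> 1" using \<phi>(1) by (intro norm_blinfun_bound) auto
    have "norm x \<le> norm (bidual_eval x) * norm \<phi>"
      using norm_blinfun[of "bidual_eval x" \<phi>] \<phi>(2) by simp
    also have "\<dots> \<le> norm (bidual_eval x) * 1"
      using \<open>norm \<phi> \<le> 1\<close> by (intro mult_left_mono) auto
    finally show ?thesis using B[OF that] by simp
  qed
  then show ?thesis unfolding bounded_iff by blast
qed

lemma weakly_p_summable_bounded: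
  fixes x :: "nat \<Rightarrow> 'a::real_normed_vector"
  assumes p: "0 < p" and x: "weakly_p_summable p x"
  shows "bounded (range x)"
proof (rule weakly_bounded_imp_bounded)
  fix \<phi> :: "'a \<Rightarrow>\<^sub>L real"
  have "summable (\<lambda>n. \<bar>blinfun_apply \<phi> (x n)\<bar> powr p)"
    using x unfolding weakly_p_summable_def by blast
  then have "bounded (range (\<lambda>n. \<bar>blinfun_apply \<phi> (x n)\<bar> powr p))"
    by (rule convergent_imp_bounded[OF summable_LIMSEQ_zero])
  then obtain B where B: "\<And>n. \<bar>blinfun_apply \<phi> (x n)\<bar> powr p \<le> B"
    unfolding bounded_iff by auto
  have "\<bar>blinfun_apply \<phi> (x n)\<bar> \<le> B powr (1 / p)" for n
  proof -
    have "(\<bar>blinfun_apply \<phi> (x n)\<bar> powr p) powr (1 / p) \<le> B powr (1 / p)"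
      using B p by (intro powr_mono2) auto
    then show ?thesis using p by (simp add: powr_powr)
  qed
  then show "bounded (blinfun_apply \<phi> ` range x)" unfolding bounded_iff by auto
qed

lemma weakly_p_summable_image:
  assumes "weakly_p_summable p x"
  shows "weakly_p_summable p (\<lambda>n. blinfun_apply T (x n))"
  unfolding weakly_p_summable_def
proof
  fix \<phi>
  show "summable (\<lambda>n. \<bar>blinfun_apply \<phi> (blinfun_apply T (x n))\<bar> powr p)"
    using assms[unfolded weakly_p_summable_def, rule_format, of "\<phi> o\<^sub>L T"] by simp
qed

lemma summable_subseq:
  fixes f :: "nat \<Rightarrow> real"
  assumes f: "summable f" "\<And>n. 0 \<le> f n" and r: "strict_mono r"
  shows "summable (\<lambda>n. f (r n))"
proof -
  let ?g = "\<lambda>n. if n \<in> range r then f n else 0"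
  have "summable ?g" using f by (intro summable_comparison_test[OF _ f(1)]) auto
  then show ?thesis using summable_mono_reindex[OF r, of ?g] by simp
qed

lemma weakly_p_summable_subseq:
  assumes "weakly_p_summable p x" "strict_mono r"
  shows "weakly_p_summable p (\<lambda>n. x (r n))"
  unfolding weakly_p_summable_def
proof
  fix \<phi>
  show "summable (\<lambda>n. \<bar>blinfun_apply \<phi> (x (r n))\<bar> powr p)"
    using assms(1) unfolding weakly_p_summable_def
    by (intro summable_subseq[OF _ _ assms(2), of "\<lambda>n. \<bar>blinfun_apply \<phi> (x n)\<bar> powr p"]) auto
qed

section \<open>Weakly null functionals and the Dunford--Pettis property\<close>

text \<open>
  Completeness holds over every topological space. It is used for sequences, that is for bounded
  functions on \<open>nat\<close>, which has its discrete topology but carries no metric structure.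
\<close>

instance bcontfun :: (topological_space, complete_space) complete_space
proof
  fix f :: "nat \<Rightarrow> 'a \<Rightarrow>\<^sub>C 'b"
  assume C: "Cauchy f"
  have "uniformly_Cauchy_on UNIV (\<lambda>n. apply_bcontfun (f n))"
    unfolding uniformly_Cauchy_on_def
  proof (intro allI impI)
    fix e :: real assume "0 < e"
    then obtain N where N: "\<And>m n. N \<le> m \<Longrightarrow> N \<le> n \<Longrightarrow> dist (f m) (f n) < e"
      using C unfolding Cauchy_def by blast
    show "\<exists>M. \<forall>x\<in>UNIV. \<forall>m\<ge>M. \<forall>n\<ge>M. dist (apply_bcontfun (f m) x) (apply_bcontfun (f n) x) < e"
      by (intro exI[of _ N] ballI allI impI dist_fun_lt_imp_dist_val_lt[OF N])
  qed
  then obtain l where "uniform_limit UNIV (\<lambda>n. apply_bcontfun (f n)) l sequentially"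
    using Cauchy_uniformly_convergent unfolding uniformly_convergent_on_def by blast
  then obtain l' where "f \<longlonglongrightarrow> l'"
    using uniform_limit_bcontfunE sequentially_bot by blast
  then show "convergent f" by (rule convergentI)
qed
instance bcontfun :: (topological_space, banach) banach ..

lemma compact_pointwise_bounded:
  fixes b :: "'i \<Rightarrow> real"
  shows "compact {F. \<forall>i. \<bar>F i\<bar> \<le> b i}"
proof -
  have "compactin (product_topology (\<lambda>i. euclidean) UNIV) (PiE UNIV (\<lambda>i. {- b i..b i}))"
    unfolding compactin_PiE by simp
  moreover have "PiE UNIV (\<lambda>i. {- b i..b i}) = {F. \<forall>i. \<bar>F i\<bar> \<le> b i}"
    by (auto simp: PiE_iff abs_le_iff minus_le_iff)
  ultimately show ?thesis by (simp add: euclidean_product_topology)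
qed

text \<open>
  The elements of the ball are plain functions, not bounded linear operators, so that the topology of the
  function type, pointwise convergence, is the weak-star topology.
\<close>

definition bidual_ball :: "(('a::real_normed_vector \<Rightarrow>\<^sub>L real) \<Rightarrow> real) set" where
  "bidual_ball = {\<xi>. (\<forall>\<phi>. \<bar>\<xi> \<phi>\<bar> \<le> norm \<phi>) \<and> (\<forall>\<phi> \<psi>. \<xi> (\<phi> + \<psi>) = \<xi> \<phi> + \<xi> \<psi>) \<and>
     (\<forall>c \<phi>. \<xi> (c *\<^sub>R \<phi>) = c * \<xi> \<phi>)}"

lemma compact_bidual_ball: "compact (bidual_ball :: (('a::real_normed_vector \<Rightarrow>\<^sub>L real) \<Rightarrow> real) set)"
proof -
  have "closed {\<xi> :: ('a \<Rightarrow>\<^sub>L real) \<Rightarrow> real. \<forall>\<phi> \<psi>. \<xi> (\<phi> + \<psi>) = \<xi> \<phi> + \<xi> \<psi>}"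
    by (intro closed_Collect_all closed_Collect_eq continuous_intros continuous_on_product_coordinates)
  moreover have "closed {\<xi> :: ('a \<Rightarrow>\<^sub>L real) \<Rightarrow> real. \<forall>c \<phi>. \<xi> (c *\<^sub>R \<phi>) = c * \<xi> \<phi>}"
    by (intro closed_Collect_all closed_Collect_eq continuous_intros continuous_on_product_coordinates)
  ultimately show ?thesis
    unfolding bidual_ball_def Collect_conj_eq
    by (intro compact_Int_closed compact_pointwise_bounded closed_Int)
qed

lemma bounded_linear_bidual_ball:
  assumes "\<xi> \<in> bidual_ball"
  shows "bounded_linear \<xi>"
  using assms unfolding bidual_ball_def
  by (intro bounded_linear_intro[where K = 1]) auto

lemma bidual_ball_weakly_null:
  assumes "\<xi> \<in> bidual_ball" "weakly_null \<psi>"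
  shows "(\<lambda>n. \<xi> (\<psi> n)) \<longlonglongrightarrow> 0"
  using assms(2)[unfolded weakly_null_def, rule_format, of "Blinfun \<xi>"]
    bounded_linear_Blinfun_apply[OF bounded_linear_bidual_ball[OF assms(1)]] by simp

lemma eval_in_bidual_ball:
  assumes "norm x \<le> 1"
  shows "(\<lambda>\<phi>. blinfun_apply \<phi> x) \<in> bidual_ball"
proof -
  have "\<bar>blinfun_apply \<phi> x\<bar> \<le> norm \<phi>" for \<phi> :: "'a \<Rightarrow>\<^sub>L real"
    using norm_blinfun[of \<phi> x] mult_left_mono[OF assms, of "norm \<phi>"] by simp
  then show ?thesis unfolding bidual_ball_def by (simp add: blinfun.add_left blinfun.scaleR_left)
qed

lemma dual_type_str_iff:
  "\<phi> \<in> dual_str (type_str :: 'a::real_normed_vector normed_str) \<longleftrightarrow>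
    (\<exists>\<eta> :: 'a \<Rightarrow>\<^sub>L real. \<phi> = blinfun_apply \<eta>)"
proof
  assume "\<phi> \<in> dual_str (type_str :: 'a normed_str)"
  then obtain B where "\<And>x y. \<phi> (x + y) = \<phi> x + \<phi> y" "\<And>c x. \<phi> (c *\<^sub>R x) = c * \<phi> x"
    "\<And>x. \<bar>\<phi> x\<bar> \<le> B * norm x"
    unfolding dual_str_def type_str_def by auto
  then have "bounded_linear \<phi>"
    by (intro bounded_linear_intro[where K = B]) (auto simp: mult.commute)
  then show "\<exists>\<eta> :: 'a \<Rightarrow>\<^sub>L real. \<phi> = blinfun_apply \<eta>"
    by (metis bounded_linear_Blinfun_apply)
next
  assume "\<exists>\<eta> :: 'a \<Rightarrow>\<^sub>L real. \<phi> = blinfun_apply \<eta>"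
  then obtain \<eta> :: "'a \<Rightarrow>\<^sub>L real" where "\<phi> = blinfun_apply \<eta>" ..
  then show "\<phi> \<in> dual_str (type_str :: 'a normed_str)"
    unfolding dual_str_def type_str_def
    using norm_blinfun[of \<eta>] by (auto simp: blinfun.add_right blinfun.scaleR_right)
qed

lemma Hausdorff_weak_type_str:
  "Hausdorff_space (weak_topology (type_str :: 'a::real_normed_vector normed_str))"
  unfolding Hausdorff_space_def topspace_weak_topology
proof (intro allI impI)
  fix x y :: 'a
  assume "x \<in> car type_str \<and> y \<in> car type_str \<and> x \<noteq> y"
  then have xy: "x \<noteq> y" by blast
  obtain \<eta> :: "'a \<Rightarrow>\<^sub>L real" where "\<bar>blinfun_apply \<eta> (x - y)\<bar> = norm (x - y)"
    using exists_norming_functional by blast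
  then have neq: "blinfun_apply \<eta> x \<noteq> blinfun_apply \<eta> y" using xy by (auto simp: blinfun.diff_right)
  obtain U V where UV: "open U" "open V" "blinfun_apply \<eta> x \<in> U" "blinfun_apply \<eta> y \<in> V"
    "U \<inter> V = {}"
    using hausdorff[OF neq] by blast
  have \<eta>: "blinfun_apply \<eta> \<in> dual_str type_str" unfolding dual_type_str_iff by blast
  let ?A = "\<lambda>W. {w \<in> car (type_str :: 'a normed_str). blinfun_apply \<eta> w \<in> W}"
  have "openin (weak_topology type_str) (?A U)" "openin (weak_topology type_str) (?A V)"
    using openin_weak_topology[OF \<eta>] UV(1,2) by blast+
  moreover have "x \<in> ?A U" "y \<in> ?A V" "disjnt (?A U) (?A V)"
    using UV(3-5) by (auto simp: type_str_def disjnt_def)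
  ultimately show "\<exists>U V. openin (weak_topology type_str) U \<and> openin (weak_topology type_str) V \<and>
      x \<in> U \<and> y \<in> V \<and> disjnt U V"
    by (intro exI[of _ "?A U"] exI[of _ "?A V"] conjI)
qed

lemma apply_Bcontfun_nat:
  fixes v :: "nat \<Rightarrow> real"
  assumes "\<And>n. \<bar>v n\<bar> \<le> B"
  shows "apply_bcontfun (Bcontfun v) = v"
  using assms by (intro Bcontfun_inverse bcontfun_normI[where b = B]) auto

definition unit_seq :: "nat \<Rightarrow> nat \<Rightarrow>\<^sub>C real" where
  "unit_seq n = Bcontfun (\<lambda>m. if m = n then 1 else 0)"

lemma apply_unit_seq: "apply_bcontfun (unit_seq n) m = (if m = n then 1 else 0)"
  unfolding unit_seq_def by (subst apply_Bcontfun_nat[where B = 1]) auto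

lemma apply_sum_unit_seq:
  "apply_bcontfun (\<Sum>n<N. c n *\<^sub>R unit_seq n) m = (if m < N then c m else 0)"
  by (induction N) (auto simp: apply_unit_seq less_Suc_eq)

text \<open>
  This lemma and the next one are the duality between \<open>c\<^sub>0\<close> and \<open>\<ell>\<^sub>1\<close>. They concern
  functionals on all bounded sequences, but describe them on null sequences only.
\<close>

lemma summable_functional_on_unit_seq:
  fixes \<eta> :: "(nat \<Rightarrow>\<^sub>C real) \<Rightarrow>\<^sub>L real"
  shows "summable (\<lambda>n. \<bar>blinfun_apply \<eta> (unit_seq n)\<bar>)"
proof (rule summableI_nonneg_bounded)
  fix N
  let ?v = "\<Sum>n<N. sgn (blinfun_apply \<eta> (unit_seq n)) *\<^sub>R unit_seq n"
  have "norm ?v \<le> 1"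
    by (rule norm_bound) (simp add: apply_sum_unit_seq abs_sgn_eq)
  have "(\<Sum>n<N. \<bar>blinfun_apply \<eta> (unit_seq n)\<bar>) = blinfun_apply \<eta> ?v"
    by (simp add: blinfun.sum_right blinfun.scaleR_right abs_sgn mult.commute)
  also have "\<dots> \<le> norm \<eta> * norm ?v" using norm_blinfun[of \<eta> ?v] by simp
  also have "\<dots> \<le> norm \<eta> * 1" using \<open>norm ?v \<le> 1\<close> by (intro mult_left_mono) auto
  finally show "(\<Sum>n<N. \<bar>blinfun_apply \<eta> (unit_seq n)\<bar>) \<le> norm \<eta>" by simp
qed simp

lemma functional_on_null_sequence:
  fixes \<eta> :: "(nat \<Rightarrow>\<^sub>C real) \<Rightarrow>\<^sub>L real"
  assumes "apply_bcontfun v \<longlonglongrightarrow> 0"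
  shows "(\<lambda>n. apply_bcontfun v n * blinfun_apply \<eta> (unit_seq n)) sums blinfun_apply \<eta> v"
proof -
  have "(\<lambda>N. \<Sum>n<N. apply_bcontfun v n *\<^sub>R unit_seq n) \<longlonglongrightarrow> v"
  proof (rule LIMSEQ_I)
    fix e :: real assume e: "0 < e"
    obtain N0 where N0: "\<And>n. N0 \<le> n \<Longrightarrow> \<bar>apply_bcontfun v n\<bar> < e / 2"
      using LIMSEQ_D[OF assms, of "e / 2"] e by auto
    have "norm ((\<Sum>n<N. apply_bcontfun v n *\<^sub>R unit_seq n) - v) < e" if "N0 \<le> N" for N
    proof -
      have "norm ((\<Sum>n<N. apply_bcontfun v n *\<^sub>R unit_seq n) - v) \<le> e / 2"
      proof (rule norm_bound)
        fix m
        show "norm (apply_bcontfun ((\<Sum>n<N. apply_bcontfun v n *\<^sub>R unit_seq n) - v) m) \<le> e / 2"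
          using N0[of m] that e by (cases "m < N") (auto simp: apply_sum_unit_seq)
      qed
      then show ?thesis using e by simp
    qed
    then show "\<exists>N0. \<forall>N\<ge>N0. norm ((\<Sum>n<N. apply_bcontfun v n *\<^sub>R unit_seq n) - v) < e" by blast
  qed
  from blinfun.tendsto[OF tendsto_const this, of \<eta>] show ?thesis
    unfolding sums_def by (simp add: blinfun.sum_right blinfun.scaleR_right)
qed

text \<open>
  The operator \<open>S\<close> extends to the bidual by \<open>\<xi> \<mapsto> (\<xi> (\<psi> n))\<^sub>n\<close>, and weak nullity of \<open>\<psi>\<close> puts
  the values of the extension in \<open>c\<^sub>0\<close>. A functional \<open>\<eta>\<close> acts on \<open>c\<^sub>0\<close> through a
  summable sequence \<open>a\<close>, so \<open>\<xi> \<mapsto> \<Sum>n. a n * \<xi> (\<psi> n)\<close> is a uniform limit of weak-star continuous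
  functions on the ball of the bidual. Thus the image of that compact ball is weakly compact, and
  it contains the image of the unit ball of the original space.
\<close>

theorem weakly_compact_weakly_null:
  fixes \<psi> :: "nat \<Rightarrow> 'a::banach \<Rightarrow>\<^sub>L real" and S :: "'a \<Rightarrow>\<^sub>L (nat \<Rightarrow>\<^sub>C real)"
  assumes null: "weakly_null \<psi>"
    and S: "\<And>x n. apply_bcontfun (blinfun_apply S x) n = blinfun_apply (\<psi> n) x"
  shows "weakly_compact_into type_str (blinfun_apply S)"
proof -
  obtain M where M: "\<And>n. norm (\<psi> n) \<le> M"
    using weakly_null_dual_bounded[OF null] unfolding bounded_iff by auto
  define D where "D = (bidual_ball :: (('a \<Rightarrow>\<^sub>L real) \<Rightarrow> real) set)"
  define Q where "Q \<xi> = Bcontfun (\<lambda>n. \<xi> (\<psi> n))" for \<xi> :: "('a \<Rightarrow>\<^sub>L real) \<Rightarrow> real"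
  have bd: "\<bar>\<xi> (\<psi> n)\<bar> \<le> M" if "\<xi> \<in> D" for \<xi> n
  proof -
    have "\<bar>\<xi> (\<psi> n)\<bar> \<le> norm (\<psi> n)" using that unfolding D_def bidual_ball_def by blast
    then show ?thesis using M[of n] by linarith
  qed
  have Q: "apply_bcontfun (Q \<xi>) = (\<lambda>n. \<xi> (\<psi> n))" if "\<xi> \<in> D" for \<xi>
    unfolding Q_def by (rule apply_Bcontfun_nat[OF bd[OF that]])
  have cont: "continuous_on D (\<lambda>\<xi>. blinfun_apply \<eta> (Q \<xi>))" for \<eta> :: "(nat \<Rightarrow>\<^sub>C real) \<Rightarrow>\<^sub>L real"
  proof -
    let ?a = "\<lambda>n. blinfun_apply \<eta> (unit_seq n)"
    have "uniform_limit D (\<lambda>N \<xi>. \<Sum>n<N. \<xi> (\<psi> n) * ?a n) (\<lambda>\<xi>. \<Sum>n. \<xi> (\<psi> n) * ?a n) sequentially"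
    proof (rule Weierstrass_m_test)
      show "norm (\<xi> (\<psi> n) * ?a n) \<le> M * \<bar>?a n\<bar>" if "\<xi> \<in> D" for n \<xi>
        using bd[OF that, of n] by (simp add: abs_mult mult_right_mono)
      show "summable (\<lambda>n. M * \<bar>?a n\<bar>)"
        by (intro summable_mult summable_functional_on_unit_seq)
    qed
    moreover have "continuous_on D (\<lambda>\<xi>. \<Sum>n<N. \<xi> (\<psi> n) * ?a n)" for N
      by (intro continuous_intros continuous_on_subset[OF continuous_on_product_coordinates]) auto
    ultimately have "continuous_on D (\<lambda>\<xi>. \<Sum>n. \<xi> (\<psi> n) * ?a n)"
      by (intro uniform_limit_theorem[where F = sequentially]) auto
    moreover have "(\<Sum>n. \<xi> (\<psi> n) * ?a n) = blinfun_apply \<eta> (Q \<xi>)" if "\<xi> \<in> D" for \<xi>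
      using functional_on_null_sequence[of "Q \<xi>" \<eta>] bidual_ball_weakly_null[OF _ null, of \<xi>]
        that Q[OF that] by (simp add: D_def sums_iff)
    ultimately show ?thesis by (simp cong: continuous_on_cong)
  qed
  have "continuous_map (top_of_set D) (weak_topology type_str) Q"
    unfolding weak_topology_def continuous_on_generated_topo_iff
  proof (intro conjI allI impI)
    fix V assume "V \<in> {{z \<in> car (type_str :: (nat \<Rightarrow>\<^sub>C real) normed_str). \<phi> z \<in> U} |\<phi> U.
        \<phi> \<in> dual_str type_str \<and> open U}"
    then obtain \<eta> :: "(nat \<Rightarrow>\<^sub>C real) \<Rightarrow>\<^sub>L real" and U
      where V: "V = {z \<in> car type_str. blinfun_apply \<eta> z \<in> U}" "open U"
      unfolding dual_type_str_iff by blast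
    have "Q -` V \<inter> topspace (top_of_set D) = D \<inter> (\<lambda>\<xi>. blinfun_apply \<eta> (Q \<xi>)) -` U"
      unfolding V(1) by (auto simp: type_str_def)
    then show "openin (top_of_set D) (Q -` V \<inter> topspace (top_of_set D))"
      using continuous_openin_preimage_gen[OF cont V(2)] by simp
  next
    show "Q ` topspace (top_of_set D) \<subseteq> \<Union> {{z \<in> car (type_str :: (nat \<Rightarrow>\<^sub>C real) normed_str).
        \<phi> z \<in> U} |\<phi> U. \<phi> \<in> dual_str type_str \<and> open U}"
      using topspace_weak_topology[of "type_str :: (nat \<Rightarrow>\<^sub>C real) normed_str"]
      unfolding weak_topology_def topology_generated_by_topspace by (simp add: type_str_def)
  qed
  moreover have "compactin (top_of_set D) D"
    using compact_bidual_ball unfolding D_def by (simp add: compactin_subtopology)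
  ultimately have comp: "compactin (weak_topology type_str) (Q ` D)"
    using image_compactin by blast
  have "blinfun_apply S ` cball 0 1 \<subseteq> Q ` D"
  proof
    fix v assume "v \<in> blinfun_apply S ` cball 0 1"
    then obtain x where x: "norm x \<le> 1" "v = blinfun_apply S x" by auto
    have "(\<lambda>\<phi>. blinfun_apply \<phi> x) \<in> D" unfolding D_def by (rule eval_in_bidual_ball[OF x(1)])
    moreover from Q[OF this] have "v = Q (\<lambda>\<phi>. blinfun_apply \<phi> x)"
      unfolding x(2) by (intro bcontfun_eqI) (simp add: S)
    ultimately show "v \<in> Q ` D" by blast
  qed
  then have "weak_topology type_str closure_of (blinfun_apply S ` cball 0 1) \<subseteq> Q ` D"
    using compactin_imp_closedin[OF Hausdorff_weak_type_str comp] by (rule closure_of_minimal)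
  then have "compactin (weak_topology type_str)
      (weak_topology type_str closure_of (blinfun_apply S ` cball 0 1))"
    by (rule closed_compactin[OF comp _ closedin_closure_of])
  moreover have "bounded_operator_into type_str (blinfun_apply S)"
    unfolding bounded_operator_into_def type_str_def
    by (auto simp: blinfun.add_right blinfun.scaleR_right intro!: exI[of _ "norm S"] norm_blinfun)
  ultimately show ?thesis unfolding weakly_compact_into_def by blast
qed

text \<open>
  As the index \<open>\<nu> m\<close> is arbitrary, this says that \<open>sup\<^sub>n \<bar>\<psi> n (x m)\<bar>\<close> tends to \<open>0\<close>: the supremum is
  the norm of the image of \<open>x m\<close> under the weakly compact operator given by \<open>\<psi>\<close>.
\<close>

theorem has_DPP_weakly_null_uniform:
  fixes \<psi> :: "nat \<Rightarrow> 'a::banach \<Rightarrow>\<^sub>L real" and x :: "nat \<Rightarrow> 'a"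
  assumes dpp: "has_DPP p TYPE('a)" and null: "weakly_null \<psi>" and x: "weakly_p_summable p x"
  shows "(\<lambda>m. blinfun_apply (\<psi> (\<nu> m)) (x m)) \<longlonglongrightarrow> 0"
proof -
  obtain M where M: "\<And>n. norm (\<psi> n) \<le> M"
    using weakly_null_dual_bounded[OF null] unfolding bounded_iff by auto
  have bd: "\<bar>blinfun_apply (\<psi> n) y\<bar> \<le> norm y * M" for n y
    using norm_blinfun[of "\<psi> n" y] mult_right_mono[OF M[of n], of "norm y"]
    by (simp add: mult.commute)
  define S where "S y = Bcontfun (\<lambda>n. blinfun_apply (\<psi> n) y)" for y
  have S: "apply_bcontfun (S y) = (\<lambda>n. blinfun_apply (\<psi> n) y)" for y
    unfolding S_def by (rule apply_Bcontfun_nat[OF bd])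
  have "bounded_linear S"
  proof (rule bounded_linear_intro[where K = M])
    show "S (y + z) = S y + S z" for y z
      by (rule bcontfun_eqI) (simp add: S blinfun.add_right)
    show "S (c *\<^sub>R y) = c *\<^sub>R S y" for c y
      by (rule bcontfun_eqI) (simp add: S blinfun.scaleR_right)
    show "norm (S y) \<le> norm y * M" for y
      by (rule norm_bound) (simp add: S bd)
  qed
  then have BS: "blinfun_apply (Blinfun S) = S" by (rule bounded_linear_Blinfun_apply)
  have "weakly_compact_into type_str (blinfun_apply (Blinfun S))"
    by (rule weakly_compact_weakly_null[OF null]) (simp add: BS S)
  from has_DPP_imp_p_convergent[OF dpp this] have "(\<lambda>m. S (x m)) \<longlonglongrightarrow> 0"
    using x unfolding p_convergent_def BS by blast
  then show ?thesis
  proof (rule Lim_null_comparison[rotated, OF tendsto_norm_zero])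
    have "norm (blinfun_apply (\<psi> (\<nu> m)) (x m)) \<le> norm (S (x m))" for m
      using norm_bounded[of "S (x m)" "\<nu> m"] by (simp add: S)
    then show "\<forall>\<^sub>F m in sequentially. norm (blinfun_apply (\<psi> (\<nu> m)) (x m)) \<le> norm (S (x m))"
      by simp
  qed
qed

section \<open>The compact ball of bilinear forms\<close>

text \<open>
  If \<open>'d\<close> is the dual of a space, these forms are the operators of norm at most one from \<open>'x\<close>
  into the bidual of that space. Functions on pairs are used, as for the ball of the
  bidual, to make the ball compact in the topology of the function type.
\<close>

definition bilinear_ball :: "('d::real_normed_vector \<times> 'x::real_normed_vector \<Rightarrow> real) set" where
  "bilinear_ball = {G. (\<forall>i. \<bar>G i\<bar> \<le> norm (fst i) * norm (snd i)) \<and>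
     (\<forall>\<phi> \<psi> x. G (\<phi> + \<psi>, x) = G (\<phi>, x) + G (\<psi>, x)) \<and>
     (\<forall>c \<phi> x. G (c *\<^sub>R \<phi>, x) = c * G (\<phi>, x)) \<and>
     (\<forall>\<phi> x y. G (\<phi>, x + y) = G (\<phi>, x) + G (\<phi>, y)) \<and>
     (\<forall>c \<phi> x. G (\<phi>, c *\<^sub>R x) = c * G (\<phi>, x))}"

lemma compact_bilinear_ball:
  "compact (bilinear_ball :: ('d::real_normed_vector \<times> 'x::real_normed_vector \<Rightarrow> real) set)"
  unfolding bilinear_ball_def Collect_conj_eq
  by (intro compact_Int_closed compact_pointwise_bounded closed_Int closed_Collect_all
      closed_Collect_eq continuous_intros continuous_on_product_coordinates)

lemma bilinear_ballD:
  assumes "G \<in> bilinear_ball"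
  shows "\<bar>G (\<phi>, x)\<bar> \<le> norm \<phi> * norm x"
    "G (\<phi> + \<psi>, x) = G (\<phi>, x) + G (\<psi>, x)" "G (c *\<^sub>R \<phi>, x) = c * G (\<phi>, x)"
    "G (\<phi>, x + y) = G (\<phi>, x) + G (\<phi>, y)" "G (\<phi>, c *\<^sub>R x) = c * G (\<phi>, x)"
proof -
  have "\<bar>G (\<phi>, x)\<bar> \<le> norm (fst (\<phi>, x)) * norm (snd (\<phi>, x))"
    using assms unfolding bilinear_ball_def by blast
  then show "\<bar>G (\<phi>, x)\<bar> \<le> norm \<phi> * norm x" by simp
qed (use assms in \<open>simp_all add: bilinear_ball_def\<close>)

lemma bilinear_ball_diff:
  assumes "G \<in> bilinear_ball"
  shows "G (\<phi>, x - y) = G (\<phi>, x) - G (\<phi>, y)"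
  using bilinear_ballD(4)[OF assms, of \<phi> "x - y" y] by simp

text \<open>
  Evaluation is not jointly continuous for pointwise convergence of forms, but on the ball the
  forms are equicontinuous in the second argument.
\<close>

lemma continuous_on_bilinear_ball:
  fixes f :: "'w::topological_space \<Rightarrow> 'x::real_normed_vector" and \<theta> :: "'d::real_normed_vector"
  assumes f: "continuous_on UNIV f"
  shows "continuous_on (UNIV \<times> bilinear_ball) (\<lambda>\<kappa>. snd \<kappa> (\<theta>, f (fst \<kappa>)))"
  unfolding continuous_on_def
proof
  let ?S = "UNIV \<times> bilinear_ball :: ('w \<times> ('d \<times> 'x \<Rightarrow> real)) set"
  fix \<kappa>0 :: "'w \<times> ('d \<times> 'x \<Rightarrow> real)" assume \<kappa>0: "\<kappa>0 \<in> ?S"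
  have "continuous_on ?S (\<lambda>\<kappa>. snd \<kappa> (\<theta>, f (fst \<kappa>0)))"
    by (rule continuous_on_product_then_coordinatewise[OF continuous_on_snd[OF continuous_on_id]])
  then have 1: "((\<lambda>\<kappa>. snd \<kappa> (\<theta>, f (fst \<kappa>0))) \<longlongrightarrow> snd \<kappa>0 (\<theta>, f (fst \<kappa>0))) (at \<kappa>0 within ?S)"
    using \<kappa>0 unfolding continuous_on_def by blast
  have "continuous_on ?S (\<lambda>\<kappa>. norm \<theta> * norm (f (fst \<kappa>) - f (fst \<kappa>0)))"
    by (intro continuous_intros continuous_on_compose2[OF f]) auto
  then have "((\<lambda>\<kappa>. norm \<theta> * norm (f (fst \<kappa>) - f (fst \<kappa>0))) \<longlongrightarrow>
      norm \<theta> * norm (f (fst \<kappa>0) - f (fst \<kappa>0))) (at \<kappa>0 within ?S)"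
    using \<kappa>0 unfolding continuous_on_def by blast
  then have 2: "((\<lambda>\<kappa>. norm \<theta> * norm (f (fst \<kappa>) - f (fst \<kappa>0))) \<longlongrightarrow> 0) (at \<kappa>0 within ?S)"
    by simp
  have "\<forall>\<^sub>F \<kappa> in at \<kappa>0 within ?S. \<kappa> \<in> ?S" by (simp add: eventually_at_filter)
  then have "\<forall>\<^sub>F \<kappa> in at \<kappa>0 within ?S.
      norm (snd \<kappa> (\<theta>, f (fst \<kappa>)) - snd \<kappa> (\<theta>, f (fst \<kappa>0))) \<le> norm \<theta> * norm (f (fst \<kappa>) - f (fst \<kappa>0))"
  proof eventually_elim
    case (elim \<kappa>)
    then have G: "snd \<kappa> \<in> bilinear_ball" by auto
    show ?case
      using bilinear_ballD(1)[OF G, of \<theta> "f (fst \<kappa>) - f (fst \<kappa>0)"]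
      unfolding bilinear_ball_diff[OF G] by simp
  qed
  then have "((\<lambda>\<kappa>. snd \<kappa> (\<theta>, f (fst \<kappa>)) - snd \<kappa> (\<theta>, f (fst \<kappa>0))) \<longlongrightarrow> 0) (at \<kappa>0 within ?S)"
    by (rule Lim_null_comparison[OF _ 2])
  from tendsto_add[OF this 1]
  show "((\<lambda>\<kappa>. snd \<kappa> (\<theta>, f (fst \<kappa>))) \<longlongrightarrow> snd \<kappa>0 (\<theta>, f (fst \<kappa>0))) (at \<kappa>0 within ?S)"
    by simp
qed

definition slice :: "('d \<times> 'x \<Rightarrow> real) \<Rightarrow> 'd \<Rightarrow> ('x::real_normed_vector \<Rightarrow>\<^sub>L real)" where
  "slice G \<phi> = Blinfun (\<lambda>x. G (\<phi>, x))"

lemma slice_apply: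
  assumes "G \<in> bilinear_ball"
  shows "blinfun_apply (slice G \<phi>) x = G (\<phi>, x)"
proof -
  have "bounded_linear (\<lambda>x. G (\<phi>, x))"
    using bilinear_ballD[OF assms]
    by (intro bounded_linear_intro[where K = "norm \<phi>"]) (auto simp: mult.commute)
  then show ?thesis unfolding slice_def by (simp add: bounded_linear_Blinfun_apply)
qed

lemma bounded_linear_slice:
  assumes G: "G \<in> bilinear_ball"
  shows "bounded_linear (slice G)"
proof (rule bounded_linear_intro[where K = 1])
  show "slice G (\<phi> + \<psi>) = slice G \<phi> + slice G \<psi>" for \<phi> \<psi>
    by (rule blinfun_eqI) (simp add: slice_apply[OF G] bilinear_ballD[OF G] blinfun.add_left)
  show "slice G (c *\<^sub>R \<phi>) = c *\<^sub>R slice G \<phi>" for c \<phi>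
    by (rule blinfun_eqI) (simp add: slice_apply[OF G] bilinear_ballD[OF G] blinfun.scaleR_left)
  show "norm (slice G \<phi>) \<le> norm \<phi> * 1" for \<phi>
    by (rule norm_blinfun_bound) (simp_all add: slice_apply[OF G] bilinear_ballD[OF G])
qed

lemma weakly_null_bounded_linear:
  fixes R :: "'a::real_normed_vector \<Rightarrow> 'b::real_normed_vector"
  assumes "bounded_linear R" "weakly_null \<phi>"
  shows "weakly_null (\<lambda>n. R (\<phi> n))"
  unfolding weakly_null_def
proof
  fix \<eta> :: "'b \<Rightarrow>\<^sub>L real"
  have "bounded_linear (\<lambda>x. blinfun_apply \<eta> (R x))"
    by (rule bounded_linear_compose[OF blinfun.bounded_linear_right assms(1)])
  from bounded_linear_Blinfun_apply[OF this]
  show "(\<lambda>n. blinfun_apply \<eta> (R (\<phi> n))) \<longlonglongrightarrow> 0"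
    using assms(2)[unfolded weakly_null_def, rule_format, of "Blinfun (\<lambda>x. blinfun_apply \<eta> (R x))"]
    by simp
qed

section \<open>Averages of dominated operators\<close>

text \<open>
  The functions \<open>f n\<close> with \<open>n < N\<close> define a continuous pseudometric; the partition consists of
  normalised tent functions of radius \<open>\<delta>\<close> for it, centred at the points of a finite \<open>\<delta>\<close>-net \<open>A\<close>.
\<close>

lemma partition_of_unity_oscillation:
  fixes f :: "nat \<Rightarrow> 'w::topological_space \<Rightarrow> 'x::real_normed_vector"
  assumes comp: "compact (UNIV :: 'w set)" and cont: "\<And>n. continuous_on UNIV (f n)" and \<delta>: "0 < \<delta>"
  obtains A :: "'w set" and e :: "'w \<Rightarrow> 'w \<Rightarrow>\<^sub>C real" where
    "finite A" "\<And>a t. a \<in> A \<Longrightarrow> 0 \<le> apply_bcontfun (e a) t"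
    "\<And>t. (\<Sum>a\<in>A. apply_bcontfun (e a) t) = 1"
    "\<And>a t n. a \<in> A \<Longrightarrow> n < N \<Longrightarrow> apply_bcontfun (e a) t \<noteq> 0 \<Longrightarrow> norm (f n t - f n a) \<le> \<delta>"
proof -
  define r where "r a t = max 0 (\<delta> - (\<Sum>n<N. norm (f n t - f n a)))" for a t
  have r_cont: "continuous_on UNIV (r a)" for a
    unfolding r_def[abs_def] by (intro continuous_intros cont)
  have "open {t. 0 < r a t}" for a :: 'w
    by (intro open_Collect_less continuous_intros r_cont)
  moreover have "UNIV \<subseteq> (\<Union>a\<in>UNIV. {t. 0 < r a t})"
  proof
    have "0 < r t t" for t unfolding r_def using \<delta> by simp
    then show "t \<in> (\<Union>a\<in>UNIV. {t. 0 < r a t})" for t by blast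
  qed
  ultimately obtain A where A: "finite A" "UNIV \<subseteq> (\<Union>a\<in>A. {t. 0 < r a t})"
    using compactE_image[OF comp, of UNIV "\<lambda>a. {t. 0 < r a t}"] by metis
  define s where "s t = (\<Sum>a\<in>A. r a t)" for t
  have r_nonneg: "0 \<le> r a t" for a t by (simp add: r_def)
  have s_pos: "0 < s t" for t
  proof -
    obtain a where "a \<in> A" "0 < r a t" using A(2) by blast
    then show ?thesis unfolding s_def using A(1) r_nonneg by (intro sum_pos2[of A a]) auto
  qed
  have s_ne: "s t \<noteq> 0" for t using s_pos[of t] by simp
  define e where "e a = Bcontfun (\<lambda>t. r a t / s t)" for a
  have e: "apply_bcontfun (e a) = (\<lambda>t. r a t / s t)" if "a \<in> A" for a
    unfolding e_def
  proof (intro Bcontfun_inverse bcontfun_normI[where b = 1])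
    show "continuous_on UNIV (\<lambda>t. r a t / s t)"
      using s_ne unfolding s_def[abs_def] by (intro continuous_intros r_cont) auto
    have "r a t \<le> s t" for t
      unfolding s_def using that A(1) r_nonneg by (intro member_le_sum) auto
    then show "norm (r a t / s t) \<le> 1" for t using s_pos[of t] r_nonneg[of a t] by simp
  qed
  show thesis
  proof (rule that[OF A(1)])
    show "0 \<le> apply_bcontfun (e a) t" if "a \<in> A" for a t
      using e[OF that] r_nonneg s_pos[of t] by simp
    show "(\<Sum>a\<in>A. apply_bcontfun (e a) t) = 1" for t
      using e s_ne[of t] by (simp add: s_def flip: sum_divide_distrib)
    show "norm (f n t - f n a) \<le> \<delta>"
      if "a \<in> A" "n < N" "apply_bcontfun (e a) t \<noteq> 0" for a t n
    proof -
      have "norm (f n t - f n a) \<le> (\<Sum>n<N. norm (f n t - f n a))"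
        using that(2) by (intro member_le_sum) auto
      moreover have "r a t \<noteq> 0" using that(3) e[OF that(1)] by auto
      ultimately show ?thesis unfolding r_def by (simp add: max_def split: if_splits)
    qed
  qed
qed

definition tensor :: "('w::topological_space \<Rightarrow>\<^sub>C real) \<Rightarrow> 'x::real_normed_vector \<Rightarrow> 'w \<Rightarrow>\<^sub>C 'x" where
  "tensor e x = Bcontfun (\<lambda>t. apply_bcontfun e t *\<^sub>R x)"

lemma apply_tensor [simp]: "apply_bcontfun (tensor e x) t = apply_bcontfun e t *\<^sub>R x"
proof -
  have "(\<lambda>t. apply_bcontfun e t *\<^sub>R x) \<in> bcontfun"
  proof (rule bcontfun_normI[where b = "norm e * norm x"])
    show "norm (apply_bcontfun e t *\<^sub>R x) \<le> norm e * norm x" for t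
      using norm_bounded[of e t] by (simp add: mult_right_mono)
  qed (intro continuous_intros continuous_on_apply_bcontfun)
  then show ?thesis unfolding tensor_def by (simp add: Bcontfun_inverse)
qed

lemma apply_bcontfun_sum: "apply_bcontfun (\<Sum>a\<in>A. g a) t = (\<Sum>a\<in>A. apply_bcontfun (g a) t)"
  by (induction A rule: infinite_finite_induct) auto

lemma tensor_linear:
  "tensor e (x + y) = tensor e x + tensor e y" "tensor e (c *\<^sub>R x) = c *\<^sub>R tensor e x"
  by (rule bcontfun_eqI, simp add: scaleR_right_distrib)+

lemma norm_diff_partition_le:
  fixes f :: "'w::topological_space \<Rightarrow>\<^sub>C 'x::real_normed_vector"
  assumes A: "finite A" "\<And>a t. a \<in> A \<Longrightarrow> 0 \<le> apply_bcontfun (e a) t"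
    "\<And>t. (\<Sum>a\<in>A. apply_bcontfun (e a) t) = 1"
    and osc: "\<And>a t. a \<in> A \<Longrightarrow> apply_bcontfun (e a) t \<noteq> 0 \<Longrightarrow>
      norm (apply_bcontfun f t - apply_bcontfun f a) \<le> \<delta>"
  shows "norm (f - (\<Sum>a\<in>A. tensor (e a) (apply_bcontfun f a))) \<le> \<delta>"
proof (rule norm_bound)
  fix t
  have "apply_bcontfun (f - (\<Sum>a\<in>A. tensor (e a) (apply_bcontfun f a))) t =
      (\<Sum>a\<in>A. apply_bcontfun (e a) t) *\<^sub>R apply_bcontfun f t -
      (\<Sum>a\<in>A. apply_bcontfun (e a) t *\<^sub>R apply_bcontfun f a)"
    by (simp add: apply_bcontfun_sum A(3))
  also have "\<dots> = (\<Sum>a\<in>A. apply_bcontfun (e a) t *\<^sub>R (apply_bcontfun f t - apply_bcontfun f a))"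
    by (simp add: scaleR_sum_left sum_subtractf scaleR_right_diff_distrib)
  also have "norm \<dots> \<le> (\<Sum>a\<in>A. apply_bcontfun (e a) t * \<delta>)"
  proof (rule sum_norm_le)
    fix a assume a: "a \<in> A"
    show "norm (apply_bcontfun (e a) t *\<^sub>R (apply_bcontfun f t - apply_bcontfun f a)) \<le>
        apply_bcontfun (e a) t * \<delta>"
      using A(2)[OF a, of t] osc[OF a, of t]
      by (cases "apply_bcontfun (e a) t = 0") (simp_all add: mult_left_mono)
  qed
  also have "\<dots> = \<delta>" by (simp add: A(3) flip: sum_distrib_right)
  finally show "norm (apply_bcontfun (f - (\<Sum>a\<in>A. tensor (e a) (apply_bcontfun f a))) t) \<le> \<delta>" .
qed

text \<open>
  The form \<open>G\<close> is the average over the weight \<open>e\<close> of the operator-valued density of \<open>T\<close> with respect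
  to the measure \<open>L\<close>. Domination bounds it by one.
\<close>

lemma dominated_average_form:
  fixes T :: "('w::topological_space \<Rightarrow>\<^sub>C 'x::real_normed_vector) \<Rightarrow>\<^sub>L 'y::real_normed_vector"
    and L :: "('w \<Rightarrow>\<^sub>C real) \<Rightarrow>\<^sub>L real"
  assumes pos: "\<And>g. (\<And>t. 0 \<le> apply_bcontfun g t) \<Longrightarrow> 0 \<le> blinfun_apply L g"
    and dom: "\<And>f. norm (blinfun_apply T f) \<le> blinfun_apply L (pointwise_norm f)"
    and e: "\<And>t. 0 \<le> apply_bcontfun e t"
  obtains G :: "('y \<Rightarrow>\<^sub>L real) \<times> 'x \<Rightarrow> real" where "G \<in> bilinear_ball"
    "\<And>\<phi> x. blinfun_apply L e * G (\<phi>, x) = blinfun_apply \<phi> (blinfun_apply T (tensor e x))"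
proof -
  define G where "G = (\<lambda>(\<phi> :: 'y \<Rightarrow>\<^sub>L real, x).
    blinfun_apply \<phi> (blinfun_apply T (tensor e x)) / blinfun_apply L e)"
  have Le: "0 \<le> blinfun_apply L e" by (rule pos[OF e])
  have bound: "\<bar>blinfun_apply \<phi> (blinfun_apply T (tensor e x))\<bar> \<le> norm \<phi> * norm x * blinfun_apply L e"
    for \<phi> :: "'y \<Rightarrow>\<^sub>L real" and x
  proof -
    have "pointwise_norm (tensor e x) = norm x *\<^sub>R e"
      using e by (intro bcontfun_eqI) simp
    then have "norm (blinfun_apply T (tensor e x)) \<le> norm x * blinfun_apply L e"
      using dom[of "tensor e x"] by (simp add: blinfun.scaleR_right)
    then have "norm \<phi> * norm (blinfun_apply T (tensor e x)) \<le> norm \<phi> * (norm x * blinfun_apply L e)"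
      by (intro mult_left_mono) auto
    then show ?thesis using norm_blinfun[of \<phi> "blinfun_apply T (tensor e x)"] by simp
  qed
  have "G \<in> bilinear_ball"
    unfolding bilinear_ball_def
  proof (intro CollectI conjI allI)
    \<comment> \<open>If \<open>e\<close> is null for \<open>L\<close>, then \<open>G\<close> is zero because division by zero gives zero.\<close>
    show "\<bar>G i\<bar> \<le> norm (fst i) * norm (snd i)" for i
    proof (cases "blinfun_apply L e = 0")
      case False
      then show ?thesis
        using bound[of "fst i" "snd i"] Le by (simp add: G_def split_beta field_simps)
    qed (simp add: G_def split_beta)
  qed (simp_all add: G_def tensor_linear blinfun.add_left blinfun.add_right blinfun.scaleR_left
      blinfun.scaleR_right add_divide_distrib)
  moreover have "blinfun_apply L e * G (\<phi>, x) = blinfun_apply \<phi> (blinfun_apply T (tensor e x))"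
    for \<phi> x
    using bound[of \<phi> x] by (cases "blinfun_apply L e = 0") (simp_all add: G_def)
  ultimately show thesis by (rule that)
qed

lemma not_null_sequence_subseq:
  fixes u :: "nat \<Rightarrow> real"
  assumes "\<not> u \<longlonglongrightarrow> 0"
  shows "\<exists>\<epsilon>>0. \<exists>r :: nat \<Rightarrow> nat. strict_mono r \<and> (\<forall>m. \<epsilon> \<le> \<bar>u (r m)\<bar>)"
proof -
  obtain \<epsilon> where \<epsilon>: "0 < \<epsilon>" "\<forall>N. \<exists>m\<ge>N. \<epsilon> \<le> \<bar>u m\<bar>"
    using assms unfolding LIMSEQ_iff by (auto simp: not_less)
  then have "infinite {m. \<epsilon> \<le> \<bar>u m\<bar>}"
    unfolding infinite_nat_iff_unbounded_le by auto
  from infinite_enumerate[OF this] show ?thesis using \<epsilon>(1) by blast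
qed

text \<open>
  Suppose that the values do not tend to zero; after passing to a subsequence and changing signs
  of the functionals they are at least \<open>\<epsilon>\<close>. The functions \<open>z m (t, G) = G (\<theta> m, F m t)\<close> on the compact
  product of \<open>'w\<close> with the ball of bilinear forms are continuous, bounded, and tend to zero
  pointwise by the Dunford--Pettis property of \<open>'x\<close>, because a form \<open>G\<close> maps the weakly null sequence
  \<open>\<phi>\<close> to a weakly null sequence in the dual of \<open>'x\<close>. So some finite convex combination \<open>g\<close> of
  them is less than \<open>c\<close> everywhere. On the other hand, a fine partition of unity expresses the
  numbers \<open>\<theta> n (T (F n))\<close>, up to \<open>\<epsilon> / 2\<close> and for all \<open>n\<close> that occur in \<open>g\<close>, as averages of \<open>z n\<close> with
  one and the same system of weights, of total mass \<open>L 1\<close>. The same average of \<open>g\<close> is then at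
  least \<open>\<epsilon> / 2\<close>, although it is at most \<open>c * L 1 < \<epsilon> / 2\<close>.
\<close>

theorem dominated_weakly_null_uniform:
  fixes T :: "('w::topological_space \<Rightarrow>\<^sub>C 'x::banach) \<Rightarrow>\<^sub>L 'y::banach"
    and \<phi> :: "nat \<Rightarrow> 'y \<Rightarrow>\<^sub>L real"
  assumes p: "0 < p" and comp: "compact (UNIV :: 'w set)"
    and dpp: "has_DPP p TYPE('x)" and dominated: "dominated T"
    and null: "weakly_null \<phi>" and f: "weakly_p_summable p f"
  shows "(\<lambda>m. blinfun_apply (\<phi> (\<nu> m)) (blinfun_apply T (f m))) \<longlonglongrightarrow> 0"
proof (rule ccontr)
  assume "\<not> ?thesis"
  from not_null_sequence_subseq[OF this] obtain \<epsilon> and r :: "nat \<Rightarrow> nat"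
    where \<epsilon>: "0 < \<epsilon>" and r: "strict_mono r"
    and large: "\<And>m. \<epsilon> \<le> \<bar>blinfun_apply (\<phi> (\<nu> (r m))) (blinfun_apply T (f (r m)))\<bar>"
    by blast
  obtain L :: "('w \<Rightarrow>\<^sub>C real) \<Rightarrow>\<^sub>L real" where
    pos: "\<And>g. (\<And>t. 0 \<le> apply_bcontfun g t) \<Longrightarrow> 0 \<le> blinfun_apply L g" and
    dom: "\<And>f. norm (blinfun_apply T f) \<le> blinfun_apply L (pointwise_norm f)"
    using dominated unfolding dominated_def by blast
  define F where "F m = f (r m)" for m
  define \<theta> where "\<theta> m = sgn (blinfun_apply (\<phi> (\<nu> (r m))) (blinfun_apply T (F m))) *\<^sub>R \<phi> (\<nu> (r m))" for m
  have \<theta>_large: "\<epsilon> \<le> blinfun_apply (\<theta> m) (blinfun_apply T (F m))" for m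
    using large[of m] by (simp add: \<theta>_def F_def blinfun.scaleR_left abs_sgn mult.commute)
  have F: "weakly_p_summable p F"
    unfolding F_def by (rule weakly_p_summable_subseq[OF f r])
  obtain B where B: "\<And>m. norm (F m) \<le> B"
    using weakly_p_summable_bounded[OF p F] unfolding bounded_iff by auto
  obtain M where M: "\<And>n. norm (\<phi> n) \<le> M"
    using weakly_null_dual_bounded[OF null] unfolding bounded_iff by auto
  have M0: "0 \<le> M" using M[of 0] norm_ge_zero order_trans by blast
  have \<theta>M: "norm (\<theta> m) \<le> M" for m
    using M[of "\<nu> (r m)"] M0 by (simp add: \<theta>_def abs_sgn_eq)
  define K where "K = (UNIV :: 'w set) \<times> (bilinear_ball :: (('y \<Rightarrow>\<^sub>L real) \<times> 'x \<Rightarrow> real) set)"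
  define z where "z m \<kappa> = snd \<kappa> (\<theta> m, apply_bcontfun (F m) (fst \<kappa>))"
    for m and \<kappa> :: "'w \<times> (('y \<Rightarrow>\<^sub>L real) \<times> 'x \<Rightarrow> real)"
  define W where "W = blinfun_apply L (const_bcontfun 1)"
  have W: "0 \<le> W" unfolding W_def by (rule pos) simp
  \<comment> \<open>The summand \<open>1\<close> covers the case \<open>W = 0\<close>.\<close>
  define c where "c = \<epsilon> / (2 * (W + 1))"
  have c: "0 < c" using \<epsilon> W by (simp add: c_def)
  have "\<exists>g\<in>convex_tail z 0. \<forall>\<kappa>\<in>K. g \<kappa> < c"
  proof (rule pointwise_null_imp_small_convex_combination[OF _ _ _ _ c])
    show "compact K" unfolding K_def by (intro compact_Times comp compact_bilinear_ball)
    show "continuous_on K (z m)" for m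
      unfolding K_def z_def[abs_def]
      by (intro continuous_on_bilinear_ball continuous_on_apply_bcontfun)
    show "\<bar>z m \<kappa>\<bar> \<le> M * B" if "\<kappa> \<in> K" for m \<kappa>
    proof -
      have "snd \<kappa> \<in> bilinear_ball" using that unfolding K_def by auto
      then have "\<bar>z m \<kappa>\<bar> \<le> norm (\<theta> m) * norm (apply_bcontfun (F m) (fst \<kappa>))"
        unfolding z_def by (rule bilinear_ballD)
      also have "\<dots> \<le> M * B"
        using \<theta>M M0 order_trans[OF norm_bounded B] by (intro mult_mono) auto
      finally show ?thesis .
    qed
    show "(\<lambda>m. z m \<kappa>) \<longlonglongrightarrow> 0" if "\<kappa> \<in> K" for \<kappa>
    proof -
      obtain t G where \<kappa>: "\<kappa> = (t, G)" and G: "G \<in> bilinear_ball" using \<open>\<kappa> \<in> K\<close> unfolding K_def by auto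
      have ev: "bounded_linear (\<lambda>h :: 'w \<Rightarrow>\<^sub>C 'x. apply_bcontfun h t)"
        by (rule bounded_linear_intro[where K = 1]) (auto simp: norm_bounded)
      from weakly_p_summable_image[OF F, of "Blinfun (\<lambda>h. apply_bcontfun h t)"]
      have "weakly_p_summable p (\<lambda>m. apply_bcontfun (F m) t)"
        by (simp add: bounded_linear_Blinfun_apply[OF ev])
      moreover have "weakly_null (\<lambda>n. slice G (\<phi> n))"
        by (rule weakly_null_bounded_linear[OF bounded_linear_slice[OF G] null])
      ultimately have "(\<lambda>m. blinfun_apply (slice G (\<phi> (\<nu> (r m)))) (apply_bcontfun (F m) t)) \<longlonglongrightarrow> 0"
        by (intro has_DPP_weakly_null_uniform[OF dpp, of "\<lambda>n. slice G (\<phi> n)"])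
      then show ?thesis
      proof (rule Lim_null_comparison[rotated, OF tendsto_norm_zero])
        have "norm (z m \<kappa>) \<le> norm (blinfun_apply (slice G (\<phi> (\<nu> (r m)))) (apply_bcontfun (F m) t))" for m
          by (simp add: z_def \<kappa> \<theta>_def slice_apply[OF G] bilinear_ballD(3)[OF G] abs_mult abs_sgn_eq)
        then show "\<forall>\<^sub>F m in sequentially. norm (z m \<kappa>) \<le>
            norm (blinfun_apply (slice G (\<phi> (\<nu> (r m)))) (apply_bcontfun (F m) t))"
          by simp
      qed
    qed
  qed
  then obtain g where g: "g \<in> convex_tail z 0" and g_small: "\<And>\<kappa>. \<kappa> \<in> K \<Longrightarrow> g \<kappa> < c" by blast
  obtain N where N: "\<And>(I :: 'w set) w \<kappa>. (\<forall>n<N. \<epsilon> / 2 \<le> (\<Sum>i\<in>I. w i * z n (\<kappa> i))) \<Longrightarrow>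
      \<epsilon> / 2 \<le> (\<Sum>i\<in>I. w i * g (\<kappa> i))"
    using convex_tail_average[OF g, of "\<epsilon> / 2"] by blast
  define \<delta> where "\<delta> = \<epsilon> / (2 * (M * norm T + 1))"
  have MT: "0 \<le> M * norm T" using M0 by simp
  have \<delta>: "0 < \<delta>" "M * norm T * \<delta> \<le> \<epsilon> / 2" using \<epsilon> MT by (auto simp: \<delta>_def field_simps)
  obtain A and e :: "'w \<Rightarrow> 'w \<Rightarrow>\<^sub>C real" where
    A: "finite A" "\<And>a t. a \<in> A \<Longrightarrow> 0 \<le> apply_bcontfun (e a) t"
      "\<And>t. (\<Sum>a\<in>A. apply_bcontfun (e a) t) = 1" and
    osc: "\<And>a t n. a \<in> A \<Longrightarrow> n < N \<Longrightarrow> apply_bcontfun (e a) t \<noteq> 0 \<Longrightarrow>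
      norm (apply_bcontfun (F n) t - apply_bcontfun (F n) a) \<le> \<delta>"
    using partition_of_unity_oscillation[OF comp _ \<delta>(1), of "\<lambda>n. apply_bcontfun (F n)" N]
      continuous_on_apply_bcontfun by metis
  have "\<forall>a\<in>A. \<exists>G :: ('y \<Rightarrow>\<^sub>L real) \<times> 'x \<Rightarrow> real. G \<in> bilinear_ball \<and> (\<forall>\<phi> x.
      blinfun_apply L (e a) * G (\<phi>, x) = blinfun_apply \<phi> (blinfun_apply T (tensor (e a) x)))"
    using dominated_average_form[OF pos dom A(2)] by metis
  then obtain G :: "'w \<Rightarrow> ('y \<Rightarrow>\<^sub>L real) \<times> 'x \<Rightarrow> real" where
    G: "\<And>a. a \<in> A \<Longrightarrow> G a \<in> bilinear_ball" and
    LG: "\<And>a \<phi> x. a \<in> A \<Longrightarrow>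
      blinfun_apply L (e a) * G a (\<phi>, x) = blinfun_apply \<phi> (blinfun_apply T (tensor (e a) x))"
    by metis
  have "\<epsilon> / 2 \<le> (\<Sum>a\<in>A. blinfun_apply L (e a) * g (a, G a))"
  proof (rule N, intro allI impI)
    fix n assume n: "n < N"
    let ?s = "\<Sum>a\<in>A. tensor (e a) (apply_bcontfun (F n) a)"
    have "norm (F n - ?s) \<le> \<delta>" using osc[OF _ n] by (intro norm_diff_partition_le A)
    then have "norm T * norm (F n - ?s) \<le> norm T * \<delta>" by (intro mult_left_mono) auto
    then have "norm (blinfun_apply T (F n - ?s)) \<le> norm T * \<delta>"
      using norm_blinfun[of T "F n - ?s"] by linarith
    then have "norm (\<theta> n) * norm (blinfun_apply T (F n - ?s)) \<le> M * (norm T * \<delta>)"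
      using \<theta>M M0 by (intro mult_mono) auto
    then have "\<bar>blinfun_apply (\<theta> n) (blinfun_apply T (F n - ?s))\<bar> \<le> \<epsilon> / 2"
      using norm_blinfun[of "\<theta> n" "blinfun_apply T (F n - ?s)"] \<delta>(2) by simp
    then have "\<epsilon> / 2 \<le> blinfun_apply (\<theta> n) (blinfun_apply T ?s)"
      using \<theta>_large[of n] unfolding blinfun.diff_right by linarith
    also have "\<dots> = (\<Sum>a\<in>A. blinfun_apply L (e a) * z n (a, G a))"
      by (simp add: z_def LG blinfun.sum_right)
    finally show "\<epsilon> / 2 \<le> (\<Sum>a\<in>A. blinfun_apply L (e a) * z n (a, G a))" .
  qed
  also have "\<dots> \<le> (\<Sum>a\<in>A. blinfun_apply L (e a) * c)"
  proof (rule sum_mono)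
    fix a assume a: "a \<in> A"
    have "(a, G a) \<in> K" unfolding K_def using G[OF a] by simp
    then show "blinfun_apply L (e a) * g (a, G a) \<le> blinfun_apply L (e a) * c"
      using pos[OF A(2)[OF a]] g_small by (intro mult_left_mono) (auto intro: less_imp_le)
  qed
  also have "\<dots> = W * c"
  proof -
    have "(\<Sum>a\<in>A. e a) = const_bcontfun 1"
      by (rule bcontfun_eqI) (simp add: apply_bcontfun_sum A(3))
    then show ?thesis unfolding W_def by (simp flip: sum_distrib_right blinfun.sum_right)
  qed
  also have "\<dots> < \<epsilon> / 2" using \<epsilon> W by (simp add: c_def field_simps)
  finally show False by simp
qed

text \<open>
  Uniformity in \<open>m\<close> as \<open>n\<close> grows follows from uniformity in \<open>n\<close> as \<open>m\<close> grows, since only finitely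
  many \<open>m\<close> remain and \<open>\<phi>\<close> tends to zero at each vector.
\<close>

theorem dominated_dunford_pettis_set:
  fixes T :: "('w::topological_space \<Rightarrow>\<^sub>C 'x::banach) \<Rightarrow>\<^sub>L 'y::banach"
  assumes p: "0 < p" and comp: "compact (UNIV :: 'w set)"
    and dpp: "has_DPP p TYPE('x)" and dominated: "dominated T"
    and f: "weakly_p_summable p f"
  shows "dunford_pettis_set (range (\<lambda>m. blinfun_apply T (f m)))"
  unfolding dunford_pettis_set_def
proof (intro conjI allI impI)
  show "bounded (range (\<lambda>m. blinfun_apply T (f m)))"
    by (rule weakly_p_summable_bounded[OF p weakly_p_summable_image[OF f]])
  fix \<phi> :: "nat \<Rightarrow> 'y \<Rightarrow>\<^sub>L real" assume null: "weakly_null \<phi>"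
  show "uniform_limit (range (\<lambda>m. blinfun_apply T (f m)))
      (\<lambda>n y. blinfun_apply (\<phi> n) y) (\<lambda>_. 0) sequentially"
  proof (rule uniform_limitI)
    fix \<epsilon> :: real assume \<epsilon>: "0 < \<epsilon>"
    have "\<exists>m0. \<forall>m\<ge>m0. \<forall>n. \<bar>blinfun_apply (\<phi> n) (blinfun_apply T (f m))\<bar> < \<epsilon>"
    proof (rule ccontr)
      define \<nu> where "\<nu> m = (SOME n. \<epsilon> \<le> \<bar>blinfun_apply (\<phi> n) (blinfun_apply T (f m))\<bar>)" for m
      assume "\<not> ?thesis"
      then have "\<forall>m0. \<exists>m\<ge>m0. \<exists>n. \<epsilon> \<le> \<bar>blinfun_apply (\<phi> n) (blinfun_apply T (f m))\<bar>"
        by (auto simp: not_less)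
      then have "\<forall>m0. \<exists>m\<ge>m0. \<epsilon> \<le> \<bar>blinfun_apply (\<phi> (\<nu> m)) (blinfun_apply T (f m))\<bar>"
        unfolding \<nu>_def by (meson someI_ex)
      moreover obtain m0 where
        "\<And>m. m0 \<le> m \<Longrightarrow> \<bar>blinfun_apply (\<phi> (\<nu> m)) (blinfun_apply T (f m))\<bar> < \<epsilon>"
        using LIMSEQ_D[OF dominated_weakly_null_uniform[OF p comp dpp dominated null f, of \<nu>] \<epsilon>]
        by auto
      ultimately show False by (meson not_less)
    qed
    then obtain m0 where m0: "\<And>m n. m0 \<le> m \<Longrightarrow> \<bar>blinfun_apply (\<phi> n) (blinfun_apply T (f m))\<bar> < \<epsilon>"
      by blast
    have "\<forall>m\<in>{..<m0}. \<forall>\<^sub>F n in sequentially. \<bar>blinfun_apply (\<phi> n) (blinfun_apply T (f m))\<bar> < \<epsilon>"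
      using tendstoD[OF weakly_null_pointwise[OF null] \<epsilon>] by (simp add: dist_real_def)
    then have "\<forall>\<^sub>F n in sequentially. \<forall>m\<in>{..<m0}. \<bar>blinfun_apply (\<phi> n) (blinfun_apply T (f m))\<bar> < \<epsilon>"
      by (simp add: eventually_ball_finite_distrib)
    then show "\<forall>\<^sub>F n in sequentially. \<forall>y\<in>range (\<lambda>m. blinfun_apply T (f m)).
        dist (blinfun_apply (\<phi> n) y) 0 < \<epsilon>"
      by eventually_elim (use m0 in \<open>auto simp: not_less[symmetric]\<close>)
  qed
qed

theorem theorem3p20:
  fixes p :: real
    and T :: "('w::t2_space \<Rightarrow>\<^sub>C 'x::banach) \<Rightarrow>\<^sub>L 'y::banach"
  assumes "1 \<le> p"
    and "compact (UNIV :: 'w set)"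
    and "has_DPrcP p TYPE('y)"
    and "has_DPP p TYPE('x)"
    and "dominated T"
  shows "p_convergent p T"
  unfolding p_convergent_def
proof (intro allI impI)
  fix f :: "nat \<Rightarrow> 'w \<Rightarrow>\<^sub>C 'x" assume f: "weakly_p_summable p f"
  have "dunford_pettis_set (range (\<lambda>m. blinfun_apply T (f m)))"
    using assms by (intro dominated_dunford_pettis_set[OF _ _ _ _ f]) auto
  then show "(\<lambda>m. blinfun_apply T (f m)) \<longlonglongrightarrow> 0"
    using assms(3) weakly_p_summable_image[OF f] unfolding has_DPrcP_def by blast
qed

end
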